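(* With the operations $\wedge$ (conjunction) and $\vee$ (disjunction), the class of DMTS and the class of NAA over a finite alphabet $\Sigma$ each form bounded distributive lattices up to $\equiv_m$; i.e. modulo $\equiv_m$, ordered by $\le_m$, each class is a bounded lattice with meet $\wedge$ and join $\vee$ satisfying the distributive laws.
   Context: NAA: $(S,S^0,\mathrm{Tran})$, $S^0\subseteq S$ finite, $\mathrm{Tran}:S\to 2^{\mathcal P_{\mathrm{fin}}(\Sigma\times S)}$; NAA modal refinement $R$: for $(s_1,s_2)\in R$ and $M_1\in\mathrm{Tran}_1(s_1)$ there is $M_2\in\mathrm{Tran}_2(s_2)$ such that each $(a,t_1)\in M_1$ is matched by some $(a,t_2)\in M_2$ with $(t_1,t_2)\in R$ and vice versa. DMTS: $(S,S^0,\dashrightarrow,\longrightarrow)$ with $S^0$ finite, image-finite may relation $\dashrightarrow\subseteq S\times\Sigma\times S$ and must relation $\longrightarrow\subseteq S\times 2^{\Sigma\times S}$, with $s\longrightarrow N,(a,t)\in N\Rightarrow s\overset a\dashrightarrow t$; DMTS modal refinement $R$: for $(s_1,s_2)\in R$, each $s_1\overset a\dashrightarrow t_1$ is matched by some $s_2\overset a\dashrightarrow t_2$ with $(t_1,t_2)\in R$, and each $s_2\longrightarrow N_2$ by some $s_1\longrightarrow N_1$ with each $(a,t_1)\in N_1$ having $(a,t_2)\in N_2$, $(t_1,t_2)\in R$. A refinement is initialised if each left initial state is related to some right initial state; $S_1\le_m S_2$ iff one exists; $S_1\equiv_m S_2$ iff $S_1\le_m S_2$ and $S_2\le_m S_1$.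 Disjunction (disjoint union): NAA $S_1\vee S_2=(S_1\cup S_2,S_1^0\cup S_2^0,\mathrm{Tran}_1\cup\mathrm{Tran}_2)$; DMTS $S_1\vee S_2=(S_1\cup S_2,S_1^0\cup S_2^0,\dashrightarrow_1\cup\dashrightarrow_2,\longrightarrow_1\cup\longrightarrow_2)$. Conjunction: NAA $S_1\wedge S_2=(S_1\times S_2,S_1^0\times S_2^0,\mathrm{Tran})$ with $\mathrm{Tran}((s_1,s_2))=\{M\subseteq\Sigma\times S_1\times S_2\mid\pi_1(M)\in\mathrm{Tran}_1(s_1),\pi_2(M)\in\mathrm{Tran}_2(s_2)\}$, $\pi_1(M)=\{(a,s_1)\mid\exists s_2:(a,s_1,s_2)\in M\}$, $\pi_2$ symmetric. DMTS $S_1\wedge S_2=(S_1\times S_2,S_1^0\times S_2^0,\dashrightarrow,\longrightarrow)$ with $(s_1,s_2)\overset a\dashrightarrow(t_1,t_2)$ iff $s_1\overset a\dashrightarrow_1t_1$ and $s_2\overset a\dashrightarrow_2t_2$; for each $s_1\longrightarrow_1N_1$, $(s_1,s_2)\longrightarrow\{(a,(t_1,t_2))\mid(a,t_1)\in N_1,(s_1,s_2)\overset a\dashrightarrow(t_1,t_2)\}$, and symmetrically for each $s_2\longrightarrow_2N_2$. *)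

theory Defs
  imports Main
begin

text \<open>
  Specifications carry an explicit state set inside a type of states, and the alphabet is an
  explicit set \<open>\<Sigma>\<close>. Binary operations combine specifications over different state types:
  disjunction lives on the sum type and conjunction on the product type.
\<close>

record ('l, 's) dmts =
  dstates :: "'s set"
  dinit :: "'s set"
  may :: "('s \<times> 'l \<times> 's) set"
  must :: "('s \<times> ('l \<times> 's) set) set"

definition DMTS :: "'l set \<Rightarrow> ('l, 's) dmts set" where
  "DMTS \<Sigma> = {D.
     dinit D \<subseteq> dstates D \<and> finite (dinit D) \<and>
     may D \<subseteq> dstates D \<times> \<Sigma> \<times> dstates D \<and>
     must D \<subseteq> dstates D \<times> Pow (\<Sigma> \<times> dstates D) \<and>
     (\<forall>s a. finite {t. (s, a, t) \<in> may D}) \<and>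
     (\<forall>s N a t. (s, N) \<in> must D \<longrightarrow> (a, t) \<in> N \<longrightarrow> (s, a, t) \<in> may D)}"

definition dmts_refinement ::
  "('l, 's) dmts \<Rightarrow> ('l, 't) dmts \<Rightarrow> ('s \<times> 't) set \<Rightarrow> bool" where
  "dmts_refinement D1 D2 R \<longleftrightarrow>
     R \<subseteq> dstates D1 \<times> dstates D2 \<and>
     (\<forall>(s1, s2) \<in> R.
        (\<forall>a t1. (s1, a, t1) \<in> may D1 \<longrightarrow> (\<exists>t2. (s2, a, t2) \<in> may D2 \<and> (t1, t2) \<in> R)) \<and>
        (\<forall>N2. (s2, N2) \<in> must D2 \<longrightarrow>
           (\<exists>N1. (s1, N1) \<in> must D1 \<and>
              (\<forall>(a, t1) \<in> N1. \<exists>t2. (a, t2) \<in> N2 \<and> (t1, t2) \<in> R))))"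

definition dmts_le :: "('l, 's) dmts \<Rightarrow> ('l, 't) dmts \<Rightarrow> bool" (infix "\<le>\<^sub>D" 50) where
  "D1 \<le>\<^sub>D D2 \<longleftrightarrow>
     (\<exists>R. dmts_refinement D1 D2 R \<and> (\<forall>s1 \<in> dinit D1. \<exists>s2 \<in> dinit D2. (s1, s2) \<in> R))"

definition dmts_equiv :: "('l, 's) dmts \<Rightarrow> ('l, 't) dmts \<Rightarrow> bool" (infix "\<equiv>\<^sub>D" 50) where
  "D1 \<equiv>\<^sub>D D2 \<longleftrightarrow> D1 \<le>\<^sub>D D2 \<and> D2 \<le>\<^sub>D D1"

definition dmts_disj :: "('l, 's) dmts \<Rightarrow> ('l, 't) dmts \<Rightarrow> ('l, 's + 't) dmts"
    (infixl "\<or>\<^sub>D" 65) where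
  "D1 \<or>\<^sub>D D2 = \<lparr>
     dstates = dstates D1 <+> dstates D2,
     dinit = dinit D1 <+> dinit D2,
     may = {(Inl s, a, Inl t) | s a t. (s, a, t) \<in> may D1} \<union>
           {(Inr s, a, Inr t) | s a t. (s, a, t) \<in> may D2},
     must = {(Inl s, map_prod id Inl ` N) | s N. (s, N) \<in> must D1} \<union>
            {(Inr s, map_prod id Inr ` N) | s N. (s, N) \<in> must D2}\<rparr>"

definition may_conj ::
  "('l, 's) dmts \<Rightarrow> ('l, 't) dmts \<Rightarrow> (('s \<times> 't) \<times> 'l \<times> ('s \<times> 't)) set" where
  "may_conj D1 D2 =
     {((s1, s2), a, (t1, t2)) | s1 s2 a t1 t2. (s1, a, t1) \<in> may D1 \<and> (s2, a, t2) \<in> may D2}"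

definition dmts_conj :: "('l, 's) dmts \<Rightarrow> ('l, 't) dmts \<Rightarrow> ('l, 's \<times> 't) dmts"
    (infixl "\<and>\<^sub>D" 70) where
  "D1 \<and>\<^sub>D D2 = \<lparr>
     dstates = dstates D1 \<times> dstates D2,
     dinit = dinit D1 \<times> dinit D2,
     may = may_conj D1 D2,
     must =
       {((s1, s2), {(a, (t1, t2)). (a, t1) \<in> N1 \<and> ((s1, s2), a, (t1, t2)) \<in> may_conj D1 D2})
         | s1 s2 N1. (s1, N1) \<in> must D1 \<and> s2 \<in> dstates D2} \<union>
       {((s1, s2), {(a, (t1, t2)). (a, t2) \<in> N2 \<and> ((s1, s2), a, (t1, t2)) \<in> may_conj D1 D2})
         | s1 s2 N2. s1 \<in> dstates D1 \<and> (s2, N2) \<in> must D2}\<rparr>"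

definition dmts_bot :: "('l, unit) dmts" where
  "dmts_bot = \<lparr>dstates = {}, dinit = {}, may = {}, must = {}\<rparr>"

definition dmts_top :: "'l set \<Rightarrow> ('l, unit) dmts" where
  "dmts_top \<Sigma> = \<lparr>dstates = {()}, dinit = {()}, may = {()} \<times> \<Sigma> \<times> {()}, must = {}\<rparr>"

record ('l, 's) naa =
  nstates :: "'s set"
  ninit :: "'s set"
  tran :: "'s \<Rightarrow> ('l \<times> 's) set set"

definition NAA :: "'l set \<Rightarrow> ('l, 's) naa set" where
  "NAA \<Sigma> = {A.
     ninit A \<subseteq> nstates A \<and> finite (ninit A) \<and>
     (\<forall>s \<in> nstates A. tran A s \<subseteq> Fpow (\<Sigma> \<times> nstates A))}"

definition naa_refinement ::
  "('l, 's) naa \<Rightarrow> ('l, 't) naa \<Rightarrow> ('s \<times> 't) set \<Rightarrow> bool" where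
  "naa_refinement A1 A2 R \<longleftrightarrow>
     R \<subseteq> nstates A1 \<times> nstates A2 \<and>
     (\<forall>(s1, s2) \<in> R. \<forall>M1 \<in> tran A1 s1. \<exists>M2 \<in> tran A2 s2.
        (\<forall>(a, t1) \<in> M1. \<exists>t2. (a, t2) \<in> M2 \<and> (t1, t2) \<in> R) \<and>
        (\<forall>(a, t2) \<in> M2. \<exists>t1. (a, t1) \<in> M1 \<and> (t1, t2) \<in> R))"

definition naa_le :: "('l, 's) naa \<Rightarrow> ('l, 't) naa \<Rightarrow> bool" (infix "\<le>\<^sub>N" 50) where
  "A1 \<le>\<^sub>N A2 \<longleftrightarrow>
     (\<exists>R. naa_refinement A1 A2 R \<and> (\<forall>s1 \<in> ninit A1. \<exists>s2 \<in> ninit A2. (s1, s2) \<in> R))"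

definition naa_equiv :: "('l, 's) naa \<Rightarrow> ('l, 't) naa \<Rightarrow> bool" (infix "\<equiv>\<^sub>N" 50) where
  "A1 \<equiv>\<^sub>N A2 \<longleftrightarrow> A1 \<le>\<^sub>N A2 \<and> A2 \<le>\<^sub>N A1"

definition naa_disj :: "('l, 's) naa \<Rightarrow> ('l, 't) naa \<Rightarrow> ('l, 's + 't) naa"
    (infixl "\<or>\<^sub>N" 65) where
  "A1 \<or>\<^sub>N A2 = \<lparr>
     nstates = nstates A1 <+> nstates A2,
     ninit = ninit A1 <+> ninit A2,
     tran = (\<lambda>s. case s of
         Inl s1 \<Rightarrow> (\<lambda>M. map_prod id Inl ` M) ` tran A1 s1
       | Inr s2 \<Rightarrow> (\<lambda>M. map_prod id Inr ` M) ` tran A2 s2)\<rparr>"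

definition proj1 :: "('l \<times> ('s \<times> 't)) set \<Rightarrow> ('l \<times> 's) set" where
  "proj1 M = {(a, s1). \<exists>s2. (a, (s1, s2)) \<in> M}"

definition proj2 :: "('l \<times> ('s \<times> 't)) set \<Rightarrow> ('l \<times> 't) set" where
  "proj2 M = {(a, s2). \<exists>s1. (a, (s1, s2)) \<in> M}"

definition naa_conj :: "'l set \<Rightarrow> ('l, 's) naa \<Rightarrow> ('l, 't) naa \<Rightarrow> ('l, 's \<times> 't) naa" where
  "naa_conj \<Sigma> A1 A2 = \<lparr>
     nstates = nstates A1 \<times> nstates A2,
     ninit = ninit A1 \<times> ninit A2,
     tran = (\<lambda>(s1, s2). {M. M \<subseteq> \<Sigma> \<times> (nstates A1 \<times> nstates A2) \<and>
                            proj1 M \<in> tran A1 s1 \<and> proj2 M \<in> tran A2 s2})\<rparr>"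

definition naa_bot :: "('l, unit) naa" where
  "naa_bot = \<lparr>nstates = {}, ninit = {}, tran = (\<lambda>_. {})\<rparr>"

definition naa_top :: "'l set \<Rightarrow> ('l, unit) naa" where
  "naa_top \<Sigma> = \<lparr>nstates = {()}, ninit = {()}, tran = (\<lambda>_. Pow (\<Sigma> \<times> {()}))\<rparr>"

end

theory Submission
  imports Defs
begin

text \<open>
  Each inequality is witnessed by an explicit refinement: the greatest lower bound property by
  intersecting two refinements over a common left state, the least upper bound property by their
  union over the summands. The inequality
  \<open>A \<and> (B \<or> C) \<le> (A \<and> B) \<or> (A \<and> C)\<close> holds because transitions of a disjunction never leave the
  summand they start in. Everything else (congruence and the remaining distributive
  inequalities) follows order-theoretically.
\<close>

section \<open>DMTS\<close>

text \<open>Both operations change the state type, so no single type carries the lattice. The laws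
  are inequalities between specifications over arbitrary state types, and equivalence as mutual
  refinement takes the place of a quotient. The two halves share their order theory but meet
  different obstacles at the greatest lower bound. For DMTS, a must-transition of a conjunction
  stems from one conjunct only, so the answer of the common left specification says nothing about
  the other component; consistency of must with may fills this gap. For NAA, two independently
  chosen sets \<open>M1\<close> and \<open>M2\<close> have to be fused into one set with exactly
  these projections that still matches the left set, so only elements with a common origin on the
  left may be paired. Distributivity of meet over join is a retagging of states:
  \<open>(s1, Inl s2)\<close> corresponds to \<open>Inl (s1, s2)\<close>, and likewise for
  \<open>Inr\<close>. The dual law needs no further refinement relation.\<close>

lemma DMTS_D:
  assumes "D \<in> DMTS \<Sigma>"
  shows "s \<in> dinit D \<Longrightarrow> s \<in> dstates D"
    and "finite (dinit D)"
    and "(s, a, t) \<in> may D \<Longrightarrow> s \<in> dstates D \<and> a \<in> \<Sigma> \<and> t \<in> dstates D"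
    and "(s, N) \<in> must D \<Longrightarrow> s \<in> dstates D"
    and "finite {t. (s, a, t) \<in> may D}"
    and "(s, N) \<in> must D \<Longrightarrow> (a, t) \<in> N \<Longrightarrow> (s, a, t) \<in> may D"
  using assms unfolding DMTS_def by blast+

text \<open>That must-sets lie in \<open>Pow (\<Sigma> \<times> dstates D)\<close> follows from the
  last and the third premise: their elements are may-transitions, which stay within alphabet and
  carrier.\<close>

lemma DMTS_I:
  assumes "\<And>s. s \<in> dinit D \<Longrightarrow> s \<in> dstates D"
    and "finite (dinit D)"
    and "\<And>s a t. (s, a, t) \<in> may D \<Longrightarrow> s \<in> dstates D \<and> a \<in> \<Sigma> \<and> t \<in> dstates D"
    and "\<And>s N. (s, N) \<in> must D \<Longrightarrow> s \<in> dstates D"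
    and "\<And>s a. finite {t. (s, a, t) \<in> may D}"
    and "\<And>s N a t. (s, N) \<in> must D \<Longrightarrow> (a, t) \<in> N \<Longrightarrow> (s, a, t) \<in> may D"
  shows "D \<in> DMTS \<Sigma>"
  unfolding DMTS_def using assms by fast

text \<open>An initialised refinement as a curried predicate, so that composites can be written with
  \<open>OO\<close>, \<open>case_sum\<close> and lambda terms.\<close>

definition dmts_sim :: "('l, 's) dmts \<Rightarrow> ('l, 't) dmts \<Rightarrow> ('s \<Rightarrow> 't \<Rightarrow> bool) \<Rightarrow> bool" where
  "dmts_sim D1 D2 R \<longleftrightarrow>
    (\<forall>s1 \<in> dinit D1. \<exists>s2 \<in> dinit D2. R s1 s2) \<and> dmts_refinement D1 D2 {(s1, s2). R s1 s2}"

lemma dmts_le_iff_sim: "D1 \<le>\<^sub>D D2 \<longleftrightarrow> (\<exists>R. dmts_sim D1 D2 R)"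
proof
  assume "D1 \<le>\<^sub>D D2"
  then obtain R where "dmts_sim D1 D2 (\<lambda>s1 s2. (s1, s2) \<in> R)"
    unfolding dmts_le_def dmts_sim_def by auto
  then show "\<exists>R. dmts_sim D1 D2 R" by blast
next
  assume "\<exists>R. dmts_sim D1 D2 R"
  then show "D1 \<le>\<^sub>D D2"
    unfolding dmts_le_def dmts_sim_def by (metis case_prodI mem_Collect_eq)
qed

lemma dmts_simD:
  assumes "dmts_sim D1 D2 R"
  shows "s1 \<in> dinit D1 \<Longrightarrow> \<exists>s2 \<in> dinit D2. R s1 s2"
    and "R s1 s2 \<Longrightarrow> s1 \<in> dstates D1 \<and> s2 \<in> dstates D2"
    and "R s1 s2 \<Longrightarrow> (s1, a, t1) \<in> may D1 \<Longrightarrow> \<exists>t2. (s2, a, t2) \<in> may D2 \<and> R t1 t2"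
    and "R s1 s2 \<Longrightarrow> (s2, N2) \<in> must D2 \<Longrightarrow>
      \<exists>N1. (s1, N1) \<in> must D1 \<and> (\<forall>a t1. (a, t1) \<in> N1 \<longrightarrow> (\<exists>t2. (a, t2) \<in> N2 \<and> R t1 t2))"
  using assms unfolding dmts_sim_def dmts_refinement_def by fast+

lemma dmts_leI:
  assumes "\<And>s1. s1 \<in> dinit D1 \<Longrightarrow> \<exists>s2 \<in> dinit D2. R s1 s2"
    and "\<And>s1 s2. R s1 s2 \<Longrightarrow> s1 \<in> dstates D1 \<and> s2 \<in> dstates D2"
    and "\<And>s1 s2 a t1. R s1 s2 \<Longrightarrow> (s1, a, t1) \<in> may D1 \<Longrightarrow> \<exists>t2. (s2, a, t2) \<in> may D2 \<and> R t1 t2"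
    and "\<And>s1 s2 N2. R s1 s2 \<Longrightarrow> (s2, N2) \<in> must D2 \<Longrightarrow>
      \<exists>N1. (s1, N1) \<in> must D1 \<and> (\<forall>a t1. (a, t1) \<in> N1 \<longrightarrow> (\<exists>t2. (a, t2) \<in> N2 \<and> R t1 t2))"
  shows "D1 \<le>\<^sub>D D2"
proof -
  have "dmts_sim D1 D2 R"
    unfolding dmts_sim_def dmts_refinement_def using assms by (auto simp: split_beta) (metis prod.collapse)
  then show ?thesis unfolding dmts_le_iff_sim by blast
qed

lemma dmts_conj_sel [simp]:
  "dstates (D1 \<and>\<^sub>D D2) = dstates D1 \<times> dstates D2"
  "dinit (D1 \<and>\<^sub>D D2) = dinit D1 \<times> dinit D2"
  "((s1, s2), a, (t1, t2)) \<in> may (D1 \<and>\<^sub>D D2) \<longleftrightarrow> (s1, a, t1) \<in> may D1 \<and> (s2, a, t2) \<in> may D2"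
  by (auto simp: dmts_conj_def may_conj_def)

lemma must_dmts_conj:
  "((s1, s2), N) \<in> must (D1 \<and>\<^sub>D D2) \<longleftrightarrow>
    (\<exists>N1. (s1, N1) \<in> must D1 \<and> s2 \<in> dstates D2 \<and>
      N = {(a, (t1, t2)). (a, t1) \<in> N1 \<and> (s1, a, t1) \<in> may D1 \<and> (s2, a, t2) \<in> may D2}) \<or>
    (\<exists>N2. (s2, N2) \<in> must D2 \<and> s1 \<in> dstates D1 \<and>
      N = {(a, (t1, t2)). (a, t2) \<in> N2 \<and> (s1, a, t1) \<in> may D1 \<and> (s2, a, t2) \<in> may D2})"
  by (auto simp: dmts_conj_def may_conj_def)

text \<open>Splitting the transition rules by the injection of the source makes rewriting itself
  deliver that the target keeps the tag of the source.\<close>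

lemma dmts_disj_sel [simp]:
  "dstates (D1 \<or>\<^sub>D D2) = dstates D1 <+> dstates D2"
  "dinit (D1 \<or>\<^sub>D D2) = dinit D1 <+> dinit D2"
  "(Inl s1, a, y) \<in> may (D1 \<or>\<^sub>D D2) \<longleftrightarrow> (\<exists>t1. y = Inl t1 \<and> (s1, a, t1) \<in> may D1)"
  "(Inr s2, a, y) \<in> may (D1 \<or>\<^sub>D D2) \<longleftrightarrow> (\<exists>t2. y = Inr t2 \<and> (s2, a, t2) \<in> may D2)"
  "(Inl s1, N) \<in> must (D1 \<or>\<^sub>D D2) \<longleftrightarrow> (\<exists>N1. N = map_prod id Inl ` N1 \<and> (s1, N1) \<in> must D1)"
  "(Inr s2, N) \<in> must (D1 \<or>\<^sub>D D2) \<longleftrightarrow> (\<exists>N2. N = map_prod id Inr ` N2 \<and> (s2, N2) \<in> must D2)"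
  by (auto simp: dmts_disj_def)

text \<open>Membership in a tagged set becomes an equation \<open>x = f t\<close>, which freeness of
  constructors settles when \<open>f\<close> is \<open>Inl\<close> or \<open>Inr\<close>.\<close>

lemma mem_map_prod_id_image [simp]: "(a, x) \<in> map_prod id f ` N \<longleftrightarrow> (\<exists>t. x = f t \<and> (a, t) \<in> N)"
  by force

section \<open>DMTS: modal refinement is a preorder\<close>

lemma dmts_le_refl: "D \<in> DMTS \<Sigma> \<Longrightarrow> D \<le>\<^sub>D D"
  \<comment> \<open>The diagonal is cut down to \<open>dstates D\<close> because a refinement must
    lie within the carriers; targets of may- and must-transitions remain in it.\<close>
  by (rule dmts_leI[where R = "\<lambda>s t. s = t \<and> s \<in> dstates D"]) (use DMTS_D in fast)+

text \<open>Relational composition works although the two clauses run in opposite directions: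
  may-transitions are pushed from \<open>D1\<close> to \<open>D3\<close>, whereas a must-transition
  of \<open>D3\<close> is pulled back to \<open>D1\<close>, after which the targets of the answering
  set are pushed forward again.\<close>

lemma dmts_le_trans:
  assumes "D1 \<le>\<^sub>D D2" "D2 \<le>\<^sub>D D3"
  shows "D1 \<le>\<^sub>D D3"
proof -
  from assms(1) obtain R where "dmts_sim D1 D2 R" unfolding dmts_le_iff_sim by blast
  note R = dmts_simD[OF this]
  from assms(2) obtain Q where "dmts_sim D2 D3 Q" unfolding dmts_le_iff_sim by blast
  note Q = dmts_simD[OF this]
  show ?thesis
  proof (rule dmts_leI[where R = "R OO Q"])
    fix s1 s3 N3
    assume "(R OO Q) s1 s3" and N3: "(s3, N3) \<in> must D3"
    then obtain s2 where s2: "R s1 s2" "Q s2 s3" by blast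
    from Q(4)[OF s2(2) N3] obtain N2 where N2: "(s2, N2) \<in> must D2"
      "\<forall>a t1. (a, t1) \<in> N2 \<longrightarrow> (\<exists>t2. (a, t2) \<in> N3 \<and> Q t1 t2)" by blast
    from R(4)[OF s2(1) N2(1)] N2(2)
    show "\<exists>N1. (s1, N1) \<in> must D1 \<and>
        (\<forall>a t1. (a, t1) \<in> N1 \<longrightarrow> (\<exists>t3. (a, t3) \<in> N3 \<and> (R OO Q) t1 t3))"
      by (meson relcomppI)
  next
    fix s1
    assume "s1 \<in> dinit D1"
    then show "\<exists>s3 \<in> dinit D3. (R OO Q) s1 s3" by (meson R(1) Q(1) relcomppI)
  next
    fix s1 s3 a t1
    assume "(R OO Q) s1 s3" and t1: "(s1, a, t1) \<in> may D1"
    then obtain s2 where s2: "R s1 s2" "Q s2 s3" by blast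
    from R(3)[OF s2(1) t1] obtain t2 where t2: "(s2, a, t2) \<in> may D2" "R t1 t2" by blast
    from Q(3)[OF s2(2) t2(1)] t2(2)
    show "\<exists>t3. (s3, a, t3) \<in> may D3 \<and> (R OO Q) t1 t3" by blast
  qed (use R(2) Q(2) in blast)
qed

section \<open>DMTS: closure under conjunction and disjunction\<close>

lemma dmts_conj_closed:
  assumes D1: "D1 \<in> DMTS \<Sigma>" and D2: "D2 \<in> DMTS \<Sigma>"
  shows "D1 \<and>\<^sub>D D2 \<in> DMTS \<Sigma>"
proof (rule DMTS_I)
  fix s a
  \<comment> \<open>Image-finiteness is inherited because the successors under one label form a
    product of two successor sets.\<close>
  have "{t. (s, a, t) \<in> may (D1 \<and>\<^sub>D D2)} =
      {t1. (fst s, a, t1) \<in> may D1} \<times> {t2. (snd s, a, t2) \<in> may D2}"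
    by (cases s) auto
  then show "finite {t. (s, a, t) \<in> may (D1 \<and>\<^sub>D D2)}"
    using DMTS_D(5)[OF D1] DMTS_D(5)[OF D2] by simp
qed (use DMTS_D[OF D1] DMTS_D[OF D2] in \<open>auto simp: must_dmts_conj\<close>)

lemma dmts_disj_closed:
  assumes D1: "D1 \<in> DMTS \<Sigma>" and D2: "D2 \<in> DMTS \<Sigma>"
  shows "D1 \<or>\<^sub>D D2 \<in> DMTS \<Sigma>"
proof (rule DMTS_I)
  fix s a
  show "finite {t. (s, a, t) \<in> may (D1 \<or>\<^sub>D D2)}"
    using DMTS_D(5)[OF D1] DMTS_D(5)[OF D2] by (cases s) auto
next
  fix s a t
  assume "(s, a, t) \<in> may (D1 \<or>\<^sub>D D2)"
  then show "s \<in> dstates (D1 \<or>\<^sub>D D2) \<and> a \<in> \<Sigma> \<and> t \<in> dstates (D1 \<or>\<^sub>D D2)"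
    using DMTS_D(3)[OF D1] DMTS_D(3)[OF D2] by (cases s) auto
next
  fix s N
  assume "(s, N) \<in> must (D1 \<or>\<^sub>D D2)"
  then show "s \<in> dstates (D1 \<or>\<^sub>D D2)"
    using DMTS_D(4)[OF D1] DMTS_D(4)[OF D2] by (cases s) auto
next
  fix s N a t
  assume "(s, N) \<in> must (D1 \<or>\<^sub>D D2)" "(a, t) \<in> N"
  then show "(s, a, t) \<in> may (D1 \<or>\<^sub>D D2)"
    using DMTS_D(6)[OF D1] DMTS_D(6)[OF D2] by (cases s; cases t) auto
qed (use DMTS_D[OF D1] DMTS_D[OF D2] in auto)

section \<open>DMTS: conjunction is the meet\<close>

lemma dmts_conj_le1:
  assumes D1: "D1 \<in> DMTS \<Sigma>" and D2: "D2 \<in> DMTS \<Sigma>"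
  shows "D1 \<and>\<^sub>D D2 \<le>\<^sub>D D1"
\<comment> \<open>The graph of the first projection. On the product carrier every must-transition of
  \<open>D1\<close> induces one of the conjunction, and the target set of the latter projects into
  the original one.\<close>
proof (rule dmts_leI[where R = "\<lambda>s t. s \<in> dstates D1 \<times> dstates D2 \<and> t = fst s"])
  fix s t N1
  assume "s \<in> dstates D1 \<times> dstates D2 \<and> t = fst s" "(t, N1) \<in> must D1"
  then have "(s, {(a, (t1, t2)). (a, t1) \<in> N1 \<and> (fst s, a, t1) \<in> may D1 \<and> (snd s, a, t2) \<in> may D2})
      \<in> must (D1 \<and>\<^sub>D D2)"
    by (cases s) (auto simp: must_dmts_conj)
  then show "\<exists>N. (s, N) \<in> must (D1 \<and>\<^sub>D D2) \<and> (\<forall>a t1. (a, t1) \<in> N \<longrightarrow>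
      (\<exists>t2. (a, t2) \<in> N1 \<and> t1 \<in> dstates D1 \<times> dstates D2 \<and> t2 = fst t1))"
    using DMTS_D(3)[OF D1] DMTS_D(3)[OF D2] by fastforce
qed (use DMTS_D(1,3)[OF D1] DMTS_D(1,3)[OF D2] in auto)

lemma dmts_conj_le2:
  assumes D1: "D1 \<in> DMTS \<Sigma>" and D2: "D2 \<in> DMTS \<Sigma>"
  shows "D1 \<and>\<^sub>D D2 \<le>\<^sub>D D2"
proof (rule dmts_leI[where R = "\<lambda>s t. s \<in> dstates D1 \<times> dstates D2 \<and> t = snd s"])
  fix s t N2
  assume "s \<in> dstates D1 \<times> dstates D2 \<and> t = snd s" "(t, N2) \<in> must D2"
  then have "(s, {(a, (t1, t2)). (a, t2) \<in> N2 \<and> (fst s, a, t1) \<in> may D1 \<and> (snd s, a, t2) \<in> may D2})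
      \<in> must (D1 \<and>\<^sub>D D2)"
    by (cases s) (auto simp: must_dmts_conj)
  then show "\<exists>N. (s, N) \<in> must (D1 \<and>\<^sub>D D2) \<and> (\<forall>a t1. (a, t1) \<in> N \<longrightarrow>
      (\<exists>t2. (a, t2) \<in> N2 \<and> t1 \<in> dstates D1 \<times> dstates D2 \<and> t2 = snd t1))"
    using DMTS_D(3)[OF D1] DMTS_D(3)[OF D2] by fastforce
qed (use DMTS_D(1,3)[OF D1] DMTS_D(1,3)[OF D2] in auto)

text \<open>The must clause is the delicate one. A must-transition of the conjunction comes from,
  say, \<open>N1\<close> in \<open>D1\<close>, and \<open>R\<close> supplies an answer
  \<open>N3\<close> in \<open>D3\<close>. Each element of \<open>N3\<close> still needs a partner in
  \<open>D2\<close>; since it is also a may-transition of \<open>D3\<close>, the may clause of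
  \<open>Q\<close> provides one.\<close>

lemma dmts_conj_greatest:
  assumes D1: "D1 \<in> DMTS \<Sigma>" and D2: "D2 \<in> DMTS \<Sigma>" and D3: "D3 \<in> DMTS \<Sigma>"
    and le: "D3 \<le>\<^sub>D D1" "D3 \<le>\<^sub>D D2"
  shows "D3 \<le>\<^sub>D D1 \<and>\<^sub>D D2"
proof -
  from le(1) obtain R where "dmts_sim D3 D1 R" unfolding dmts_le_iff_sim by blast
  note R = dmts_simD[OF this]
  from le(2) obtain Q where "dmts_sim D3 D2 Q" unfolding dmts_le_iff_sim by blast
  note Q = dmts_simD[OF this]
  show ?thesis
  proof (rule dmts_leI[where R = "\<lambda>s t. R s (fst t) \<and> Q s (snd t)"])
    fix s t N
    assume "R s (fst t) \<and> Q s (snd t)" and N: "(t, N) \<in> must (D1 \<and>\<^sub>D D2)"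
    moreover obtain s1 s2 where t: "t = (s1, s2)" by (cases t)
    ultimately have s: "R s s1" "Q s s2" by auto
    from N[unfolded t must_dmts_conj]
    show "\<exists>N3. (s, N3) \<in> must D3 \<and> (\<forall>a t1. (a, t1) \<in> N3 \<longrightarrow>
        (\<exists>t2. (a, t2) \<in> N \<and> R t1 (fst t2) \<and> Q t1 (snd t2)))"
    proof (elim disjE exE conjE)
      fix N1
      assume N1: "(s1, N1) \<in> must D1"
        and N: "N = {(a, (t1, t2)). (a, t1) \<in> N1 \<and> (s1, a, t1) \<in> may D1 \<and> (s2, a, t2) \<in> may D2}"
      from R(4)[OF s(1) N1] obtain N3 where N3: "(s, N3) \<in> must D3"
        "\<And>a t. (a, t) \<in> N3 \<Longrightarrow> \<exists>t1. (a, t1) \<in> N1 \<and> R t t1" by blast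
      have "\<exists>t2. (a, t2) \<in> N \<and> R t (fst t2) \<and> Q t (snd t2)" if "(a, t) \<in> N3" for a t
      proof -
        from N3(2)[OF that] obtain t1 where "(a, t1) \<in> N1" "R t t1" by blast
        \<comment> \<open>\<open>N1\<close> determines no second component; it is found by reading
          \<open>(a, t)\<close> as a may-transition of \<open>D3\<close>.\<close>
        moreover from Q(3)[OF s(2) DMTS_D(6)[OF D3 N3(1) that]]
        obtain t2 where "(s2, a, t2) \<in> may D2" "Q t t2" by blast
        ultimately show ?thesis
          \<comment> \<open>\<open>N\<close> retains only pairs of may-transitions, so consistency
            of \<open>D1\<close> is what lets the chosen pair pass this filter.\<close>
          using DMTS_D(6)[OF D1 N1] by (intro exI[of _ "(t1, t2)"]) (auto simp: N)
      qed
      with N3(1) show ?thesis by blast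
    next
      fix N2
      assume N2: "(s2, N2) \<in> must D2"
        and N: "N = {(a, (t1, t2)). (a, t2) \<in> N2 \<and> (s1, a, t1) \<in> may D1 \<and> (s2, a, t2) \<in> may D2}"
      from Q(4)[OF s(2) N2] obtain N3 where N3: "(s, N3) \<in> must D3"
        "\<And>a t. (a, t) \<in> N3 \<Longrightarrow> \<exists>t2. (a, t2) \<in> N2 \<and> Q t t2" by blast
      have "\<exists>t2. (a, t2) \<in> N \<and> R t (fst t2) \<and> Q t (snd t2)" if "(a, t) \<in> N3" for a t
      proof -
        from N3(2)[OF that] obtain t2 where "(a, t2) \<in> N2" "Q t t2" by blast
        moreover from R(3)[OF s(1) DMTS_D(6)[OF D3 N3(1) that]]
        obtain t1 where "(s1, a, t1) \<in> may D1" "R t t1" by blast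
        ultimately show ?thesis
          using DMTS_D(6)[OF D2 N2] by (intro exI[of _ "(t1, t2)"]) (auto simp: N)
      qed
      with N3(1) show ?thesis by blast
    qed
  next
    fix s
    assume "s \<in> dinit D3"
    from R(1)[OF this] Q(1)[OF this]
    show "\<exists>t \<in> dinit (D1 \<and>\<^sub>D D2). R s (fst t) \<and> Q s (snd t)" by auto
  next
    fix s t
    assume "R s (fst t) \<and> Q s (snd t)"
    with R(2) Q(2) show "s \<in> dstates D3 \<and> t \<in> dstates (D1 \<and>\<^sub>D D2)" by (cases t) auto
  next
    fix s t a s'
    assume t: "R s (fst t) \<and> Q s (snd t)" and s': "(s, a, s') \<in> may D3"
    from t R(3)[OF _ s'] obtain t1 where t1: "(fst t, a, t1) \<in> may D1" "R s' t1" by blast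
    from t Q(3)[OF _ s'] obtain t2 where t2: "(snd t, a, t2) \<in> may D2" "Q s' t2" by blast
    from t1 t2 show "\<exists>t'. (t, a, t') \<in> may (D1 \<and>\<^sub>D D2) \<and> R s' (fst t') \<and> Q s' (snd t')"
      by (cases t) (auto intro!: exI[of _ "(t1, t2)"])
  qed
qed

section \<open>DMTS: disjunction is the join\<close>

lemma dmts_disj_ge1:
  assumes D1: "D1 \<in> DMTS \<Sigma>"
  shows "D1 \<le>\<^sub>D D1 \<or>\<^sub>D D2"
  by (rule dmts_leI[where R = "\<lambda>s t. t = Inl s \<and> s \<in> dstates D1"])
    (use DMTS_D(1,3,6)[OF D1] in \<open>fastforce+\<close>)

lemma dmts_disj_ge2:
  assumes D2: "D2 \<in> DMTS \<Sigma>"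
  shows "D2 \<le>\<^sub>D D1 \<or>\<^sub>D D2"
  by (rule dmts_leI[where R = "\<lambda>s t. t = Inr s \<and> s \<in> dstates D2"])
    (use DMTS_D(1,3,6)[OF D2] in \<open>fastforce+\<close>)

lemma dmts_disj_least:
  assumes "D1 \<le>\<^sub>D D3" "D2 \<le>\<^sub>D D3"
  shows "D1 \<or>\<^sub>D D2 \<le>\<^sub>D D3"
proof -
  from assms(1) obtain R where "dmts_sim D1 D3 R" unfolding dmts_le_iff_sim by blast
  note R = dmts_simD[OF this]
  from assms(2) obtain Q where "dmts_sim D2 D3 Q" unfolding dmts_le_iff_sim by blast
  note Q = dmts_simD[OF this]
  show ?thesis
  \<comment> \<open>On the sum type the union of the two refinements is a case distinction on the
    tag of the left state.\<close>
  proof (rule dmts_leI[where R = "case_sum R Q"])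
    fix s u N
    assume s: "case_sum R Q s u" and N: "(u, N) \<in> must D3"
    show "\<exists>N'. (s, N') \<in> must (D1 \<or>\<^sub>D D2) \<and>
        (\<forall>a t. (a, t) \<in> N' \<longrightarrow> (\<exists>v. (a, v) \<in> N \<and> case_sum R Q t v))"
    proof (cases s)
      case (Inl s1)
      with s R(4)[OF _ N, of s1] obtain N1 where N1: "(s1, N1) \<in> must D1"
        "\<forall>a t1. (a, t1) \<in> N1 \<longrightarrow> (\<exists>t2. (a, t2) \<in> N \<and> R t1 t2)" by auto
      then show ?thesis unfolding Inl by (intro exI[of _ "map_prod id Inl ` N1"]) auto
    next
      case (Inr s2)
      with s Q(4)[OF _ N, of s2] obtain N2 where N2: "(s2, N2) \<in> must D2"
        "\<forall>a t1. (a, t1) \<in> N2 \<longrightarrow> (\<exists>t2. (a, t2) \<in> N \<and> Q t1 t2)" by auto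
      then show ?thesis unfolding Inr by (intro exI[of _ "map_prod id Inr ` N2"]) auto
    qed
  qed (use R(1-3) Q(1-3) in \<open>auto split: sum.splits\<close>)
qed

section \<open>DMTS: monotonicity and congruence\<close>

lemma dmts_conj_mono:
  assumes "D1 \<in> DMTS \<Sigma>" "D2 \<in> DMTS \<Sigma>" "D3 \<in> DMTS \<Sigma>" "D4 \<in> DMTS \<Sigma>"
    and "D1 \<le>\<^sub>D D3" "D2 \<le>\<^sub>D D4"
  shows "D1 \<and>\<^sub>D D2 \<le>\<^sub>D D3 \<and>\<^sub>D D4"
  by (rule dmts_conj_greatest[where \<Sigma> = \<Sigma>])
    (use assms dmts_conj_closed dmts_conj_le1 dmts_conj_le2 dmts_le_trans in blast)+

lemma dmts_disj_mono:
  assumes "D3 \<in> DMTS \<Sigma>" "D4 \<in> DMTS \<Sigma>" and "D1 \<le>\<^sub>D D3" "D2 \<le>\<^sub>D D4"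
  shows "D1 \<or>\<^sub>D D2 \<le>\<^sub>D D3 \<or>\<^sub>D D4"
  by (rule dmts_disj_least) (use assms dmts_disj_ge1 dmts_disj_ge2 dmts_le_trans in blast)+

lemma dmts_conj_cong:
  assumes "D1 \<in> DMTS \<Sigma>" "D2 \<in> DMTS \<Sigma>" "D3 \<in> DMTS \<Sigma>" "D4 \<in> DMTS \<Sigma>"
    and "D1 \<equiv>\<^sub>D D3" "D2 \<equiv>\<^sub>D D4"
  shows "D1 \<and>\<^sub>D D2 \<equiv>\<^sub>D D3 \<and>\<^sub>D D4"
  using assms unfolding dmts_equiv_def by (blast intro: dmts_conj_mono)

lemma dmts_disj_cong:
  assumes "D1 \<in> DMTS \<Sigma>" "D2 \<in> DMTS \<Sigma>" "D3 \<in> DMTS \<Sigma>" "D4 \<in> DMTS \<Sigma>"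
    and "D1 \<equiv>\<^sub>D D3" "D2 \<equiv>\<^sub>D D4"
  shows "D1 \<or>\<^sub>D D2 \<equiv>\<^sub>D D3 \<or>\<^sub>D D4"
  using assms unfolding dmts_equiv_def by (blast intro: dmts_disj_mono)

section \<open>DMTS: least and greatest element\<close>

lemma dmts_bot_closed: "dmts_bot \<in> DMTS \<Sigma>"
  by (simp add: DMTS_def dmts_bot_def)

lemma dmts_top_closed: "dmts_top \<Sigma> \<in> DMTS \<Sigma>"
  by (auto simp: DMTS_def dmts_top_def)

text \<open>Without initial states the empty relation is already an initialised refinement.\<close>

lemma dmts_bot_le: "dmts_bot \<le>\<^sub>D D"
  by (rule dmts_leI[where R = "\<lambda>_ _. False"]) (auto simp: dmts_bot_def)

text \<open>The single state of the top allows every action and demands nothing, so every state may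
  be related to it.\<close>

lemma dmts_le_top: "D \<in> DMTS \<Sigma> \<Longrightarrow> D \<le>\<^sub>D dmts_top \<Sigma>"
  by (rule dmts_leI[where R = "\<lambda>s _. s \<in> dstates D"]) (auto simp: dmts_top_def dest: DMTS_D)

section \<open>DMTS: distributivity\<close>

lemma dmts_conj_disj_distrib_le:
  assumes D1: "D1 \<in> DMTS \<Sigma>" and D2: "D2 \<in> DMTS \<Sigma>" and D3: "D3 \<in> DMTS \<Sigma>"
  shows "D1 \<and>\<^sub>D (D2 \<or>\<^sub>D D3) \<le>\<^sub>D (D1 \<and>\<^sub>D D2) \<or>\<^sub>D (D1 \<and>\<^sub>D D3)"
proof -
  \<comment> \<open>The graph of the canonical bijection from \<open>S1 \<times> (S2 + S3)\<close>
    to \<open>S1 \<times> S2 + S1 \<times> S3\<close>, restricted to the carriers.\<close>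
  define R where "R s t \<longleftrightarrow> s \<in> dstates D1 \<times> (dstates D2 <+> dstates D3) \<and>
      t = (case s of (s1, Inl s2) \<Rightarrow> Inl (s1, s2) | (s1, Inr s3) \<Rightarrow> Inr (s1, s3))" for s t
  have R_Inl: "R (s1, Inl s2) t \<longleftrightarrow> s1 \<in> dstates D1 \<and> s2 \<in> dstates D2 \<and> t = Inl (s1, s2)" for s1 s2 t
    by (auto simp: R_def)
  have R_Inr: "R (s1, Inr s3) t \<longleftrightarrow> s1 \<in> dstates D1 \<and> s3 \<in> dstates D3 \<and> t = Inr (s1, s3)" for s1 s3 t
    by (auto simp: R_def)
  have RE: "(\<exists>s1 s2. s = (s1, Inl s2) \<and> t = Inl (s1, s2) \<and> s1 \<in> dstates D1 \<and> s2 \<in> dstates D2) \<or>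
      (\<exists>s1 s3. s = (s1, Inr s3) \<and> t = Inr (s1, s3) \<and> s1 \<in> dstates D1 \<and> s3 \<in> dstates D3)"
    if "R s t" for s t
    using that by (auto simp: R_def)
  note st = DMTS_D(3)[OF D1] DMTS_D(3)[OF D2] DMTS_D(3)[OF D3]
  show ?thesis
  proof (rule dmts_leI[where R = R])
    fix s
    assume "s \<in> dinit (D1 \<and>\<^sub>D (D2 \<or>\<^sub>D D3))"
    then show "\<exists>t \<in> dinit ((D1 \<and>\<^sub>D D2) \<or>\<^sub>D (D1 \<and>\<^sub>D D3)). R s t"
      using R_Inl R_Inr DMTS_D(1)[OF D1] DMTS_D(1)[OF D2] DMTS_D(1)[OF D3] by fastforce
  next
    fix s t a s'
    assume "R s t" "(s, a, s') \<in> may (D1 \<and>\<^sub>D (D2 \<or>\<^sub>D D3))"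
    then show "\<exists>t'. (t, a, t') \<in> may ((D1 \<and>\<^sub>D D2) \<or>\<^sub>D (D1 \<and>\<^sub>D D3)) \<and> R s' t'"
      using st by (cases s') (auto simp: R_Inl R_Inr dest!: RE)
  next
    fix s t N
    assume "R s t" and N: "(t, N) \<in> must ((D1 \<and>\<^sub>D D2) \<or>\<^sub>D (D1 \<and>\<^sub>D D3))"
    from RE[OF \<open>R s t\<close>]
    show "\<exists>N'. (s, N') \<in> must (D1 \<and>\<^sub>D (D2 \<or>\<^sub>D D3)) \<and>
        (\<forall>a s'. (a, s') \<in> N' \<longrightarrow> (\<exists>t'. (a, t') \<in> N \<and> R s' t'))"
    proof (elim disjE exE conjE)
      fix s1 s2
      assume [simp]: "s = (s1, Inl s2)" "t = Inl (s1, s2)" and s: "s1 \<in> dstates D1" "s2 \<in> dstates D2"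
      from N obtain M where N: "N = map_prod id Inl ` M" and "((s1, s2), M) \<in> must (D1 \<and>\<^sub>D D2)" by auto
      from this(2)[unfolded must_dmts_conj] show ?thesis
      proof (elim disjE exE conjE)
        fix N1
        \<comment> \<open>The target set that the left conjunction builds from the same
          \<open>N1\<close>. As \<open>Inl s2\<close> has only \<open>Inl\<close> successors, it is
          \<open>M\<close> with the second components tagged.\<close>
        let ?N = "{(a, (t1, t2)). (a, t1) \<in> N1 \<and> (s1, a, t1) \<in> may D1 \<and> (Inl s2, a, t2) \<in> may (D2 \<or>\<^sub>D D3)}"
        assume "(s1, N1) \<in> must D1" and M:
          "M = {(a, (t1, t2)). (a, t1) \<in> N1 \<and> (s1, a, t1) \<in> may D1 \<and> (s2, a, t2) \<in> may D2}"
        then have "(s, ?N) \<in> must (D1 \<and>\<^sub>D (D2 \<or>\<^sub>D D3))"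
          using s unfolding must_dmts_conj \<open>s = _\<close> dmts_disj_sel(1) by blast
        moreover have "\<exists>t'. (a, t') \<in> N \<and> R s' t'" if "(a, s') \<in> ?N" for a s'
        proof -
          from that obtain t1 t2 where "s' = (t1, Inl t2)" "(a, (t1, t2)) \<in> M" by (auto simp: M)
          then show ?thesis using R_Inl st by (intro exI[of _ "Inl (t1, t2)"]) (auto simp: N M)
        qed
        ultimately show ?thesis by blast
      next
        fix N2
        \<comment> \<open>Here the must-transition starts in the second conjunct, so the disjunction
          first tags \<open>N2\<close>, and the outer conjunction then pairs the tagged set.\<close>
        let ?N = "{(a, (t1, t2)). (a, t2) \<in> map_prod id Inl ` N2 \<and> (s1, a, t1) \<in> may D1 \<and>
          (Inl s2, a, t2) \<in> may (D2 \<or>\<^sub>D D3)}"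
        assume "(s2, N2) \<in> must D2" and M:
          "M = {(a, (t1, t2)). (a, t2) \<in> N2 \<and> (s1, a, t1) \<in> may D1 \<and> (s2, a, t2) \<in> may D2}"
        then have "(s, ?N) \<in> must (D1 \<and>\<^sub>D (D2 \<or>\<^sub>D D3))"
          using s unfolding must_dmts_conj \<open>s = _\<close> dmts_disj_sel by blast
        moreover have "\<exists>t'. (a, t') \<in> N \<and> R s' t'" if "(a, s') \<in> ?N" for a s'
        proof -
          from that obtain t1 t2 where "s' = (t1, Inl t2)" "(a, (t1, t2)) \<in> M" by (auto simp: M)
          then show ?thesis using R_Inl st by (intro exI[of _ "Inl (t1, t2)"]) (auto simp: N M)
        qed
        ultimately show ?thesis by blast
      qed
    next
      fix s1 s2
      assume [simp]: "s = (s1, Inr s2)" "t = Inr (s1, s2)" and s: "s1 \<in> dstates D1" "s2 \<in> dstates D3"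
      from N obtain M where N: "N = map_prod id Inr ` M" and "((s1, s2), M) \<in> must (D1 \<and>\<^sub>D D3)" by auto
      from this(2)[unfolded must_dmts_conj] show ?thesis
      proof (elim disjE exE conjE)
        fix N1
        let ?N = "{(a, (t1, t2)). (a, t1) \<in> N1 \<and> (s1, a, t1) \<in> may D1 \<and> (Inr s2, a, t2) \<in> may (D2 \<or>\<^sub>D D3)}"
        assume "(s1, N1) \<in> must D1" and M:
          "M = {(a, (t1, t2)). (a, t1) \<in> N1 \<and> (s1, a, t1) \<in> may D1 \<and> (s2, a, t2) \<in> may D3}"
        then have "(s, ?N) \<in> must (D1 \<and>\<^sub>D (D2 \<or>\<^sub>D D3))"
          using s unfolding must_dmts_conj \<open>s = _\<close> dmts_disj_sel(1) by blast
        moreover have "\<exists>t'. (a, t') \<in> N \<and> R s' t'" if "(a, s') \<in> ?N" for a s'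
        proof -
          from that obtain t1 t2 where "s' = (t1, Inr t2)" "(a, (t1, t2)) \<in> M" by (auto simp: M)
          then show ?thesis using R_Inr st by (intro exI[of _ "Inr (t1, t2)"]) (auto simp: N M)
        qed
        ultimately show ?thesis by blast
      next
        fix N2
        let ?N = "{(a, (t1, t2)). (a, t2) \<in> map_prod id Inr ` N2 \<and> (s1, a, t1) \<in> may D1 \<and>
          (Inr s2, a, t2) \<in> may (D2 \<or>\<^sub>D D3)}"
        assume "(s2, N2) \<in> must D3" and M:
          "M = {(a, (t1, t2)). (a, t2) \<in> N2 \<and> (s1, a, t1) \<in> may D1 \<and> (s2, a, t2) \<in> may D3}"
        then have "(s, ?N) \<in> must (D1 \<and>\<^sub>D (D2 \<or>\<^sub>D D3))"
          using s unfolding must_dmts_conj \<open>s = _\<close> dmts_disj_sel by blast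
        moreover have "\<exists>t'. (a, t') \<in> N \<and> R s' t'" if "(a, s') \<in> ?N" for a s'
        proof -
          from that obtain t1 t2 where "s' = (t1, Inr t2)" "(a, (t1, t2)) \<in> M" by (auto simp: M)
          then show ?thesis using R_Inr st by (intro exI[of _ "Inr (t1, t2)"]) (auto simp: N M)
        qed
        ultimately show ?thesis by blast
      qed
    qed
  qed (auto dest!: RE)
qed

text \<open>The converse inequality holds in every lattice: both disjuncts lie below the left side
  by monotonicity of the meet.\<close>

lemma dmts_conj_disj_distrib:
  assumes "D1 \<in> DMTS \<Sigma>" "D2 \<in> DMTS \<Sigma>" "D3 \<in> DMTS \<Sigma>"
  shows "D1 \<and>\<^sub>D (D2 \<or>\<^sub>D D3) \<equiv>\<^sub>D (D1 \<and>\<^sub>D D2) \<or>\<^sub>D (D1 \<and>\<^sub>D D3)"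
  unfolding dmts_equiv_def
proof
  show "(D1 \<and>\<^sub>D D2) \<or>\<^sub>D (D1 \<and>\<^sub>D D3) \<le>\<^sub>D D1 \<and>\<^sub>D (D2 \<or>\<^sub>D D3)"
    using assms
    by (intro dmts_disj_least dmts_conj_mono[where \<Sigma> = \<Sigma>] dmts_le_refl[where \<Sigma> = \<Sigma>]
        dmts_disj_ge1[where \<Sigma> = \<Sigma>] dmts_disj_ge2[where \<Sigma> = \<Sigma>] dmts_disj_closed)
qed (rule dmts_conj_disj_distrib_le[OF assms])

text \<open>The usual lattice derivation from the first law. With \<open>?E\<close> for the first
  factor, the right side expands to \<open>?E\<close> met with \<open>D1\<close> or
  \<open>D3\<close>; the former is absorbed by \<open>D1\<close>, the latter is expanded once
  more.\<close>

lemma dmts_disj_conj_distrib: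
  assumes D: "D1 \<in> DMTS \<Sigma>" "D2 \<in> DMTS \<Sigma>" "D3 \<in> DMTS \<Sigma>"
  shows "D1 \<or>\<^sub>D (D2 \<and>\<^sub>D D3) \<equiv>\<^sub>D (D1 \<or>\<^sub>D D2) \<and>\<^sub>D (D1 \<or>\<^sub>D D3)"
  unfolding dmts_equiv_def
proof
  note closed = D dmts_conj_closed dmts_disj_closed
  show "D1 \<or>\<^sub>D (D2 \<and>\<^sub>D D3) \<le>\<^sub>D (D1 \<or>\<^sub>D D2) \<and>\<^sub>D (D1 \<or>\<^sub>D D3)"
    by (intro dmts_conj_greatest[where \<Sigma> = \<Sigma>] dmts_disj_mono[where \<Sigma> = \<Sigma>] dmts_le_refl[where \<Sigma> = \<Sigma>]
        dmts_conj_le1[where \<Sigma> = \<Sigma>] dmts_conj_le2[where \<Sigma> = \<Sigma>] closed)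
  let ?E = "D1 \<or>\<^sub>D D2"
  have "?E \<and>\<^sub>D (D1 \<or>\<^sub>D D3) \<le>\<^sub>D (?E \<and>\<^sub>D D1) \<or>\<^sub>D (?E \<and>\<^sub>D D3)"
    by (intro dmts_conj_disj_distrib_le[where \<Sigma> = \<Sigma>] closed)
  moreover have "?E \<and>\<^sub>D D1 \<le>\<^sub>D D1 \<or>\<^sub>D (D2 \<and>\<^sub>D D3)"
    by (rule dmts_le_trans[OF dmts_conj_le2[where \<Sigma> = \<Sigma>] dmts_disj_ge1[where \<Sigma> = \<Sigma>]]) (intro closed)+
  moreover have "?E \<and>\<^sub>D D3 \<le>\<^sub>D D1 \<or>\<^sub>D (D2 \<and>\<^sub>D D3)"
  proof -
    \<comment> \<open>The available inequality expands a disjunction in the right factor only, hence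
      the swap, justified by the universal property of the meet.\<close>
    have "?E \<and>\<^sub>D D3 \<le>\<^sub>D D3 \<and>\<^sub>D ?E"
      by (intro dmts_conj_greatest[where \<Sigma> = \<Sigma>] dmts_conj_le1[where \<Sigma> = \<Sigma>]
          dmts_conj_le2[where \<Sigma> = \<Sigma>] closed)
    moreover have "D3 \<and>\<^sub>D ?E \<le>\<^sub>D (D3 \<and>\<^sub>D D1) \<or>\<^sub>D (D3 \<and>\<^sub>D D2)"
      by (intro dmts_conj_disj_distrib_le[where \<Sigma> = \<Sigma>] closed)
    moreover have "(D3 \<and>\<^sub>D D1) \<or>\<^sub>D (D3 \<and>\<^sub>D D2) \<le>\<^sub>D D1 \<or>\<^sub>D (D2 \<and>\<^sub>D D3)"
      by (intro dmts_disj_mono[where \<Sigma> = \<Sigma>] dmts_conj_greatest[where \<Sigma> = \<Sigma>]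
          dmts_conj_le1[where \<Sigma> = \<Sigma>] dmts_conj_le2[where \<Sigma> = \<Sigma>] closed)
    ultimately show ?thesis by (blast intro: dmts_le_trans)
  qed
  ultimately show "?E \<and>\<^sub>D (D1 \<or>\<^sub>D D3) \<le>\<^sub>D D1 \<or>\<^sub>D (D2 \<and>\<^sub>D D3)"
    by (blast intro: dmts_le_trans dmts_disj_least)
qed

section \<open>NAA\<close>

lemma NAA_D:
  assumes "A \<in> NAA \<Sigma>"
  shows "s \<in> ninit A \<Longrightarrow> s \<in> nstates A"
    and "finite (ninit A)"
    and "s \<in> nstates A \<Longrightarrow> M \<in> tran A s \<Longrightarrow> finite M"
    and "s \<in> nstates A \<Longrightarrow> M \<in> tran A s \<Longrightarrow> (a, t) \<in> M \<Longrightarrow> a \<in> \<Sigma> \<and> t \<in> nstates A"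
  using assms unfolding NAA_def Fpow_def by blast+

lemma NAA_I:
  assumes "\<And>s. s \<in> ninit A \<Longrightarrow> s \<in> nstates A"
    and "finite (ninit A)"
    and "\<And>s M. s \<in> nstates A \<Longrightarrow> M \<in> tran A s \<Longrightarrow> finite M"
    and "\<And>s M a t. s \<in> nstates A \<Longrightarrow> M \<in> tran A s \<Longrightarrow> (a, t) \<in> M \<Longrightarrow> a \<in> \<Sigma> \<and> t \<in> nstates A"
  shows "A \<in> NAA \<Sigma>"
  unfolding NAA_def Fpow_def using assms by fast

text \<open>The Egli-Milner lifting of \<open>R\<close> to sets of labelled states. Isolating it
  reduces the refinement clause to one lifted relation between transition sets.\<close>

definition matched :: "('s \<Rightarrow> 't \<Rightarrow> bool) \<Rightarrow> ('l \<times> 's) set \<Rightarrow> ('l \<times> 't) set \<Rightarrow> bool" where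
  "matched R M1 M2 \<longleftrightarrow>
    (\<forall>(a, t1) \<in> M1. \<exists>t2. (a, t2) \<in> M2 \<and> R t1 t2) \<and>
    (\<forall>(a, t2) \<in> M2. \<exists>t1. (a, t1) \<in> M1 \<and> R t1 t2)"

lemma matchedI:
  assumes "\<And>a t1. (a, t1) \<in> M1 \<Longrightarrow> \<exists>t2. (a, t2) \<in> M2 \<and> R t1 t2"
    and "\<And>a t2. (a, t2) \<in> M2 \<Longrightarrow> \<exists>t1. (a, t1) \<in> M1 \<and> R t1 t2"
  shows "matched R M1 M2"
  unfolding matched_def using assms by blast

lemma matchedD:
  assumes "matched R M1 M2"
  shows "(a, t1) \<in> M1 \<Longrightarrow> \<exists>t2. (a, t2) \<in> M2 \<and> R t1 t2"
    and "(a, t2) \<in> M2 \<Longrightarrow> \<exists>t1. (a, t1) \<in> M1 \<and> R t1 t2"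
  using assms unfolding matched_def by blast+

text \<open>What transitivity requires of transition sets: an element of \<open>M2\<close> serves as
  intermediate in either direction.\<close>

lemma matched_relcompp:
  assumes R: "matched R M1 M2" and Q: "matched Q M2 M3"
  shows "matched (R OO Q) M1 M3"
proof (rule matchedI)
  fix a t1
  assume "(a, t1) \<in> M1"
  from matchedD(1)[OF R this] obtain t2 where t2: "(a, t2) \<in> M2" "R t1 t2" by blast
  from matchedD(1)[OF Q t2(1)] t2(2) show "\<exists>t3. (a, t3) \<in> M3 \<and> (R OO Q) t1 t3" by blast
next
  fix a t3
  assume "(a, t3) \<in> M3"
  from matchedD(2)[OF Q this] obtain t2 where t2: "(a, t2) \<in> M2" "Q t2 t3" by blast
  from matchedD(2)[OF R t2(1)] t2(2) show "\<exists>t1. (a, t1) \<in> M1 \<and> (R OO Q) t1 t3" by blast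
qed

text \<open>\<open>case_sum\<close> reads off the tag and falls back on \<open>R\<close> or
  \<open>Q\<close>, so tagging the left set preserves a matching; this carries the least upper bound
  property.\<close>

lemma matched_case_sum:
  "matched R M1 M \<Longrightarrow> matched (case_sum R Q) (map_prod id Inl ` M1) M"
  "matched Q M2 M \<Longrightarrow> matched (case_sum R Q) (map_prod id Inr ` M2) M"
proof -
  assume R: "matched R M1 M"
  show "matched (case_sum R Q) (map_prod id Inl ` M1) M"
    by (rule matchedI) (auto dest: matchedD(1)[OF R], use matchedD(2)[OF R] in force)
next
  assume Q: "matched Q M2 M"
  show "matched (case_sum R Q) (map_prod id Inr ` M2) M"
    by (rule matchedI) (auto dest: matchedD(1)[OF Q], use matchedD(2)[OF Q] in force)
qed

definition naa_sim :: "('l, 's) naa \<Rightarrow> ('l, 't) naa \<Rightarrow> ('s \<Rightarrow> 't \<Rightarrow> bool) \<Rightarrow> bool" where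
  "naa_sim A1 A2 R \<longleftrightarrow>
    (\<forall>s1 \<in> ninit A1. \<exists>s2 \<in> ninit A2. R s1 s2) \<and> naa_refinement A1 A2 {(s1, s2). R s1 s2}"

lemma naa_le_iff_sim: "A1 \<le>\<^sub>N A2 \<longleftrightarrow> (\<exists>R. naa_sim A1 A2 R)"
proof
  assume "A1 \<le>\<^sub>N A2"
  then obtain R where "naa_sim A1 A2 (\<lambda>s1 s2. (s1, s2) \<in> R)"
    unfolding naa_le_def naa_sim_def by auto
  then show "\<exists>R. naa_sim A1 A2 R" by blast
next
  assume "\<exists>R. naa_sim A1 A2 R"
  then show "A1 \<le>\<^sub>N A2"
    unfolding naa_le_def naa_sim_def by (metis case_prodI mem_Collect_eq)
qed

lemma naa_simD:
  assumes "naa_sim A1 A2 R"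
  shows "s1 \<in> ninit A1 \<Longrightarrow> \<exists>s2 \<in> ninit A2. R s1 s2"
    and "R s1 s2 \<Longrightarrow> s1 \<in> nstates A1 \<and> s2 \<in> nstates A2"
    and "R s1 s2 \<Longrightarrow> M1 \<in> tran A1 s1 \<Longrightarrow> \<exists>M2 \<in> tran A2 s2. matched R M1 M2"
  using assms unfolding naa_sim_def naa_refinement_def by (auto simp: matched_def)

lemma naa_leI:
  assumes "\<And>s1. s1 \<in> ninit A1 \<Longrightarrow> \<exists>s2 \<in> ninit A2. R s1 s2"
    and "\<And>s1 s2. R s1 s2 \<Longrightarrow> s1 \<in> nstates A1 \<and> s2 \<in> nstates A2"
    and "\<And>s1 s2 M1. R s1 s2 \<Longrightarrow> M1 \<in> tran A1 s1 \<Longrightarrow> \<exists>M2 \<in> tran A2 s2. matched R M1 M2"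
  shows "A1 \<le>\<^sub>N A2"
proof -
  have "naa_sim A1 A2 R"
    unfolding naa_sim_def naa_refinement_def using assms by (auto simp: matched_def)
  then show ?thesis unfolding naa_le_iff_sim by blast
qed

lemma mem_proj [simp]:
  "(a, t1) \<in> proj1 M \<longleftrightarrow> (\<exists>t2. (a, (t1, t2)) \<in> M)"
  "(a, t2) \<in> proj2 M \<longleftrightarrow> (\<exists>t1. (a, (t1, t2)) \<in> M)"
  by (auto simp: proj1_def proj2_def)

lemma naa_conj_sel [simp]:
  "nstates (naa_conj \<Sigma> A1 A2) = nstates A1 \<times> nstates A2"
  "ninit (naa_conj \<Sigma> A1 A2) = ninit A1 \<times> ninit A2"
  "M \<in> tran (naa_conj \<Sigma> A1 A2) (s1, s2) \<longleftrightarrow>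
    M \<subseteq> \<Sigma> \<times> (nstates A1 \<times> nstates A2) \<and> proj1 M \<in> tran A1 s1 \<and> proj2 M \<in> tran A2 s2"
  by (auto simp: naa_conj_def)

lemma naa_disj_sel [simp]:
  "nstates (A1 \<or>\<^sub>N A2) = nstates A1 <+> nstates A2"
  "ninit (A1 \<or>\<^sub>N A2) = ninit A1 <+> ninit A2"
  "tran (A1 \<or>\<^sub>N A2) (Inl s1) = (\<lambda>M. map_prod id Inl ` M) ` tran A1 s1"
  "tran (A1 \<or>\<^sub>N A2) (Inr s2) = (\<lambda>M. map_prod id Inr ` M) ` tran A2 s2"
  by (auto simp: naa_disj_def)

section \<open>NAA: modal refinement is a preorder\<close>

lemma naa_le_refl: "A \<in> NAA \<Sigma> \<Longrightarrow> A \<le>\<^sub>N A"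
  by (rule naa_leI[where R = "\<lambda>s t. s = t \<and> s \<in> nstates A"])
    (auto simp: matched_def dest: NAA_D)

lemma naa_le_trans:
  assumes "A1 \<le>\<^sub>N A2" "A2 \<le>\<^sub>N A3"
  shows "A1 \<le>\<^sub>N A3"
proof -
  from assms(1) obtain R where "naa_sim A1 A2 R" unfolding naa_le_iff_sim by blast
  note R = naa_simD[OF this]
  from assms(2) obtain Q where "naa_sim A2 A3 Q" unfolding naa_le_iff_sim by blast
  note Q = naa_simD[OF this]
  show ?thesis
  proof (rule naa_leI[where R = "R OO Q"])
    fix s1
    assume "s1 \<in> ninit A1"
    then show "\<exists>s3 \<in> ninit A3. (R OO Q) s1 s3" by (meson R(1) Q(1) relcomppI)
  next
    fix s1 s3 M1
    assume "(R OO Q) s1 s3" and M1: "M1 \<in> tran A1 s1"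
    then obtain s2 where s2: "R s1 s2" "Q s2 s3" by blast
    from R(3)[OF s2(1) M1] obtain M2 where M2: "M2 \<in> tran A2 s2" "matched R M1 M2" by blast
    from Q(3)[OF s2(2) M2(1)] matched_relcompp[OF M2(2)]
    show "\<exists>M3 \<in> tran A3 s3. matched (R OO Q) M1 M3" by blast
  qed (use R(2) Q(2) in blast)
qed

section \<open>NAA: closure under conjunction and disjunction\<close>

lemma naa_conj_closed:
  assumes A1: "A1 \<in> NAA \<Sigma>" and A2: "A2 \<in> NAA \<Sigma>"
  shows "naa_conj \<Sigma> A1 A2 \<in> NAA \<Sigma>"
proof (rule NAA_I)
  fix s M
  assume s: "s \<in> nstates (naa_conj \<Sigma> A1 A2)" and M: "M \<in> tran (naa_conj \<Sigma> A1 A2) s"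
  obtain s1 s2 where [simp]: "s = (s1, s2)" by (cases s)
  have "finite (proj1 M)" "finite (proj2 M)"
    using s M NAA_D(3)[OF A1] NAA_D(3)[OF A2] by auto
  \<comment> \<open>Finiteness of \<open>M\<close> comes from its projections:
    \<open>(a, (t1, t2))\<close> is recovered from the pair \<open>((a, t1), (a, t2))\<close>. Pairs
    with differing labels merely enlarge the finite cover.\<close>
  moreover have "M \<subseteq> (\<lambda>((a, t1), (b, t2)). (a, (t1, t2))) ` (proj1 M \<times> proj2 M)"
  proof clarify
    fix a t1 t2
    assume "(a, (t1, t2)) \<in> M"
    then show "(a, (t1, t2)) \<in> (\<lambda>((a, t1), (b, t2)). (a, (t1, t2))) ` (proj1 M \<times> proj2 M)"
      by (intro image_eqI[of _ _ "((a, t1), (a, t2))"]) auto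
  qed
  ultimately show "finite M" by (meson finite_SigmaI finite_imageI finite_subset)
qed (use NAA_D(1,2)[OF A1] NAA_D(1,2)[OF A2] in auto)

lemma naa_disj_closed:
  assumes A1: "A1 \<in> NAA \<Sigma>" and A2: "A2 \<in> NAA \<Sigma>"
  shows "A1 \<or>\<^sub>N A2 \<in> NAA \<Sigma>"
  by (rule NAA_I) (use NAA_D[OF A1] NAA_D[OF A2] in auto)

section \<open>NAA: conjunction is the meet\<close>

lemma naa_conj_le1:
  assumes A1: "A1 \<in> NAA \<Sigma>" and A2: "A2 \<in> NAA \<Sigma>"
  shows "naa_conj \<Sigma> A1 A2 \<le>\<^sub>N A1"
proof (rule naa_leI[where R = "\<lambda>s t. s \<in> nstates A1 \<times> nstates A2 \<and> t = fst s"])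
  fix s t M
  assume "s \<in> nstates A1 \<times> nstates A2 \<and> t = fst s" "M \<in> tran (naa_conj \<Sigma> A1 A2) s"
  then show "\<exists>M1 \<in> tran A1 t. matched (\<lambda>s t. s \<in> nstates A1 \<times> nstates A2 \<and> t = fst s) M M1"
    by (cases s) (auto intro!: bexI[of _ "proj1 M"] matchedI, blast)
qed (use NAA_D(1)[OF A1] NAA_D(1)[OF A2] in auto)

lemma naa_conj_le2:
  assumes A1: "A1 \<in> NAA \<Sigma>" and A2: "A2 \<in> NAA \<Sigma>"
  shows "naa_conj \<Sigma> A1 A2 \<le>\<^sub>N A2"
proof (rule naa_leI[where R = "\<lambda>s t. s \<in> nstates A1 \<times> nstates A2 \<and> t = snd s"])
  fix s t M
  assume "s \<in> nstates A1 \<times> nstates A2 \<and> t = snd s" "M \<in> tran (naa_conj \<Sigma> A1 A2) s"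
  then show "\<exists>M2 \<in> tran A2 t. matched (\<lambda>s t. s \<in> nstates A1 \<times> nstates A2 \<and> t = snd s) M M2"
    by (cases s) (auto intro!: bexI[of _ "proj2 M"] matchedI, blast)
qed (use NAA_D(1)[OF A1] NAA_D(1)[OF A2] in auto)

text \<open>\<open>R\<close> and \<open>Q\<close> answer \<open>M3\<close> separately by
  \<open>M1\<close> and \<open>M2\<close>. Pairing all equally labelled elements would break the
  backward matching, because a pair could lack a common preimage in \<open>M3\<close>; keeping too
  few would shrink the projections.\<close>

lemma naa_conj_greatest:
  assumes A1: "A1 \<in> NAA \<Sigma>" and A2: "A2 \<in> NAA \<Sigma>"
    and le: "A3 \<le>\<^sub>N A1" "A3 \<le>\<^sub>N A2"
  shows "A3 \<le>\<^sub>N naa_conj \<Sigma> A1 A2"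
proof -
  from le(1) obtain R where "naa_sim A3 A1 R" unfolding naa_le_iff_sim by blast
  note R = naa_simD[OF this]
  from le(2) obtain Q where "naa_sim A3 A2 Q" unfolding naa_le_iff_sim by blast
  note Q = naa_simD[OF this]
  show ?thesis
  proof (rule naa_leI[where R = "\<lambda>s t. R s (fst t) \<and> Q s (snd t)"])
    fix s
    assume "s \<in> ninit A3"
    from R(1)[OF this] Q(1)[OF this]
    show "\<exists>t \<in> ninit (naa_conj \<Sigma> A1 A2). R s (fst t) \<and> Q s (snd t)" by auto
  next
    fix s t
    assume "R s (fst t) \<and> Q s (snd t)"
    with R(2) Q(2) show "s \<in> nstates A3 \<and> t \<in> nstates (naa_conj \<Sigma> A1 A2)" by (cases t) auto
  next
    fix s t M3
    assume t: "R s (fst t) \<and> Q s (snd t)" and M3: "M3 \<in> tran A3 s"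
    obtain s1 s2 where [simp]: "t = (s1, s2)" by (cases t)
    from t have s: "R s s1" "Q s s2" by auto
    from R(3)[OF s(1) M3] obtain M1 where M1: "M1 \<in> tran A1 s1" "matched R M3 M1" by blast
    from Q(3)[OF s(2) M3] obtain M2 where M2: "M2 \<in> tran A2 s2" "matched Q M3 M2" by blast
    define M where "M = {(a, (t1, t2)) | a t1 t2.
      (a, t1) \<in> M1 \<and> (a, t2) \<in> M2 \<and> (\<exists>u. (a, u) \<in> M3 \<and> R u t1 \<and> Q u t2)}"
    have MI: "\<exists>t1 t2. (a, (t1, t2)) \<in> M \<and> R u t1 \<and> Q u t2" if "(a, u) \<in> M3" for a u
      using matchedD(1)[OF M1(2) that] matchedD(1)[OF M2(2) that] that by (auto simp: M_def)
    \<comment> \<open>No element of \<open>M1\<close> is lost: its preimage \<open>u\<close> under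
      \<open>R\<close> is also matched by \<open>Q\<close> into \<open>M2\<close>, and this yields
      the missing half. The other projection is symmetric.\<close>
    have "proj1 M = M1"
    proof (intro equalityI subrelI)
      fix a t1
      assume t1: "(a, t1) \<in> M1"
      from matchedD(2)[OF M1(2) t1] obtain u where u: "(a, u) \<in> M3" "R u t1" by blast
      from matchedD(1)[OF M2(2) u(1)] u t1 show "(a, t1) \<in> proj1 M" by (auto simp: M_def)
    qed (auto simp: M_def)
    moreover have "proj2 M = M2"
    proof (intro equalityI subrelI)
      fix a t2
      assume t2: "(a, t2) \<in> M2"
      from matchedD(2)[OF M2(2) t2] obtain u where u: "(a, u) \<in> M3" "Q u t2" by blast
      from matchedD(1)[OF M1(2) u(1)] u t2 show "(a, t2) \<in> proj2 M" by (auto simp: M_def)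
    qed (auto simp: M_def)
    moreover have "M \<subseteq> \<Sigma> \<times> (nstates A1 \<times> nstates A2)"
      using R(2)[OF s(1)] Q(2)[OF s(2)] NAA_D(4)[OF A1 _ M1(1)] NAA_D(4)[OF A2 _ M2(1)]
      by (auto simp: M_def)
    ultimately have "M \<in> tran (naa_conj \<Sigma> A1 A2) t" using M1(1) M2(1) by simp
    moreover have "matched (\<lambda>s t. R s (fst t) \<and> Q s (snd t)) M3 M"
      by (rule matchedI) (use MI in force, auto simp: M_def)
    ultimately show "\<exists>M \<in> tran (naa_conj \<Sigma> A1 A2) t.
        matched (\<lambda>s t. R s (fst t) \<and> Q s (snd t)) M3 M" ..
  qed
qed

section \<open>NAA: disjunction is the join\<close>

lemma naa_disj_ge1:
  fixes A1 :: "('l, 's) naa" and A2 :: "('l, 't) naa"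
  assumes A1: "A1 \<in> NAA \<Sigma>"
  shows "A1 \<le>\<^sub>N A1 \<or>\<^sub>N A2"
proof (rule naa_leI[where R = "\<lambda>s t. t = Inl s \<and> s \<in> nstates A1"])
  fix s M and t :: "'s + 't"
  assume "t = Inl s \<and> s \<in> nstates A1" "M \<in> tran A1 s"
  with NAA_D(4)[OF A1]
  show "\<exists>M' \<in> tran (A1 \<or>\<^sub>N A2) t. matched (\<lambda>s t. t = Inl s \<and> s \<in> nstates A1) M M'"
    by (intro bexI[of _ "map_prod id Inl ` M"] matchedI) auto
qed (use NAA_D(1)[OF A1] in auto)

lemma naa_disj_ge2:
  fixes A1 :: "('l, 's) naa" and A2 :: "('l, 't) naa"
  assumes A2: "A2 \<in> NAA \<Sigma>"
  shows "A2 \<le>\<^sub>N A1 \<or>\<^sub>N A2"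
proof (rule naa_leI[where R = "\<lambda>s t. t = Inr s \<and> s \<in> nstates A2"])
  fix s M and t :: "'s + 't"
  assume "t = Inr s \<and> s \<in> nstates A2" "M \<in> tran A2 s"
  with NAA_D(4)[OF A2]
  show "\<exists>M' \<in> tran (A1 \<or>\<^sub>N A2) t. matched (\<lambda>s t. t = Inr s \<and> s \<in> nstates A2) M M'"
    by (intro bexI[of _ "map_prod id Inr ` M"] matchedI) auto
qed (use NAA_D(1)[OF A2] in auto)

lemma naa_disj_least:
  assumes "A1 \<le>\<^sub>N A3" "A2 \<le>\<^sub>N A3"
  shows "A1 \<or>\<^sub>N A2 \<le>\<^sub>N A3"
proof -
  from assms(1) obtain R where "naa_sim A1 A3 R" unfolding naa_le_iff_sim by blast
  note R = naa_simD[OF this]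
  from assms(2) obtain Q where "naa_sim A2 A3 Q" unfolding naa_le_iff_sim by blast
  note Q = naa_simD[OF this]
  show ?thesis
  proof (rule naa_leI[where R = "case_sum R Q"])
    fix s u M
    assume s: "case_sum R Q s u" and M: "M \<in> tran (A1 \<or>\<^sub>N A2) s"
    show "\<exists>M3 \<in> tran A3 u. matched (case_sum R Q) M M3"
    proof (cases s)
      case (Inl s1)
      with M obtain M1 where M1: "M1 \<in> tran A1 s1" "M = map_prod id Inl ` M1" by auto
      with s Inl R(3) obtain M3 where "M3 \<in> tran A3 u" "matched R M1 M3" by force
      with M1(2) matched_case_sum show ?thesis by blast
    next
      case (Inr s2)
      with M obtain M2 where M2: "M2 \<in> tran A2 s2" "M = map_prod id Inr ` M2" by auto
      with s Inr Q(3) obtain M3 where "M3 \<in> tran A3 u" "matched Q M2 M3" by force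
      with M2(2) matched_case_sum show ?thesis by blast
    qed
  qed (use R(1,2) Q(1,2) in \<open>auto split: sum.splits\<close>)
qed

section \<open>NAA: monotonicity and congruence\<close>

lemma naa_conj_mono:
  assumes "A1 \<in> NAA \<Sigma>" "A2 \<in> NAA \<Sigma>" "A3 \<in> NAA \<Sigma>" "A4 \<in> NAA \<Sigma>"
    and "A1 \<le>\<^sub>N A3" "A2 \<le>\<^sub>N A4"
  shows "naa_conj \<Sigma> A1 A2 \<le>\<^sub>N naa_conj \<Sigma> A3 A4"
  by (rule naa_conj_greatest) (use assms naa_conj_le1 naa_conj_le2 naa_le_trans in blast)+

lemma naa_disj_mono:
  assumes "A3 \<in> NAA \<Sigma>" "A4 \<in> NAA \<Sigma>" and "A1 \<le>\<^sub>N A3" "A2 \<le>\<^sub>N A4"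
  shows "A1 \<or>\<^sub>N A2 \<le>\<^sub>N A3 \<or>\<^sub>N A4"
  by (rule naa_disj_least) (use assms naa_disj_ge1 naa_disj_ge2 naa_le_trans in blast)+

lemma naa_conj_cong:
  assumes "A1 \<in> NAA \<Sigma>" "A2 \<in> NAA \<Sigma>" "A3 \<in> NAA \<Sigma>" "A4 \<in> NAA \<Sigma>"
    and "A1 \<equiv>\<^sub>N A3" "A2 \<equiv>\<^sub>N A4"
  shows "naa_conj \<Sigma> A1 A2 \<equiv>\<^sub>N naa_conj \<Sigma> A3 A4"
  using assms unfolding naa_equiv_def by (blast intro: naa_conj_mono)

lemma naa_disj_cong:
  assumes "A1 \<in> NAA \<Sigma>" "A2 \<in> NAA \<Sigma>" "A3 \<in> NAA \<Sigma>" "A4 \<in> NAA \<Sigma>"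
    and "A1 \<equiv>\<^sub>N A3" "A2 \<equiv>\<^sub>N A4"
  shows "A1 \<or>\<^sub>N A2 \<equiv>\<^sub>N A3 \<or>\<^sub>N A4"
  using assms unfolding naa_equiv_def by (blast intro: naa_disj_mono)

section \<open>NAA: least and greatest element\<close>

lemma naa_bot_closed: "naa_bot \<in> NAA \<Sigma>"
  by (simp add: NAA_def naa_bot_def)

text \<open>Here finiteness of the alphabet enters: transition sets of an NAA are finite, while the
  top admits every subset of \<open>\<Sigma> \<times> {()}\<close>.\<close>

lemma naa_top_closed: "finite \<Sigma> \<Longrightarrow> naa_top \<Sigma> \<in> NAA \<Sigma>"
  by (auto simp: NAA_def naa_top_def Fpow_def intro: finite_subset)

lemma naa_bot_le: "naa_bot \<le>\<^sub>N A"
  by (rule naa_leI[where R = "\<lambda>_ _. False"]) (auto simp: naa_bot_def)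

lemma naa_le_top:
  assumes A: "A \<in> NAA \<Sigma>"
  shows "A \<le>\<^sub>N naa_top \<Sigma>"
proof (rule naa_leI[where R = "\<lambda>s _. s \<in> nstates A"])
  fix s t M
  assume "s \<in> nstates A" "M \<in> tran A s"
  with NAA_D(4)[OF A] show "\<exists>M' \<in> tran (naa_top \<Sigma>) t. matched (\<lambda>s _. s \<in> nstates A) M M'"
    \<comment> \<open>Matching runs both ways, so the answer must carry exactly the labels occurring
      in \<open>M\<close>; it is \<open>M\<close> with its states forgotten.\<close>
    by (intro bexI[of _ "map_prod id (\<lambda>_. ()) ` M"] matchedI) (auto simp: naa_top_def)
qed (auto simp: naa_top_def NAA_D(1)[OF A])

section \<open>NAA: distributivity\<close>

lemma naa_conj_disj_distrib_le:
  fixes A1 :: "('l, 's) naa" and A2 :: "('l, 't) naa" and A3 :: "('l, 'u) naa"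
  assumes A1: "A1 \<in> NAA \<Sigma>" and A2: "A2 \<in> NAA \<Sigma>" and A3: "A3 \<in> NAA \<Sigma>"
  shows "naa_conj \<Sigma> A1 (A2 \<or>\<^sub>N A3) \<le>\<^sub>N naa_conj \<Sigma> A1 A2 \<or>\<^sub>N naa_conj \<Sigma> A1 A3"
proof -
  define R where "R s t \<longleftrightarrow> s \<in> nstates A1 \<times> (nstates A2 <+> nstates A3) \<and>
      t = (case s of (s1, Inl s2) \<Rightarrow> Inl (s1, s2) | (s1, Inr s3) \<Rightarrow> Inr (s1, s3))" for s t
  have R_Inl: "R (s1, Inl s2) t \<longleftrightarrow> s1 \<in> nstates A1 \<and> s2 \<in> nstates A2 \<and> t = Inl (s1, s2)" for s1 s2 t
    by (auto simp: R_def)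
  have R_Inr: "R (s1, Inr s3) t \<longleftrightarrow> s1 \<in> nstates A1 \<and> s3 \<in> nstates A3 \<and> t = Inr (s1, s3)" for s1 s3 t
    by (auto simp: R_def)
  have RE: "(\<exists>s1 s2. s = (s1, Inl s2) \<and> t = Inl (s1, s2) \<and> s1 \<in> nstates A1 \<and> s2 \<in> nstates A2) \<or>
      (\<exists>s1 s3. s = (s1, Inr s3) \<and> t = Inr (s1, s3) \<and> s1 \<in> nstates A1 \<and> s3 \<in> nstates A3)"
    if "R s t" for s t
    using that by (auto simp: R_def)
  show ?thesis
  proof (rule naa_leI[where R = R])
    fix s
    assume "s \<in> ninit (naa_conj \<Sigma> A1 (A2 \<or>\<^sub>N A3))"
    then show "\<exists>t \<in> ninit (naa_conj \<Sigma> A1 A2 \<or>\<^sub>N naa_conj \<Sigma> A1 A3). R s t"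
      using R_Inl R_Inr NAA_D(1)[OF A1] NAA_D(1)[OF A2] NAA_D(1)[OF A3] by fastforce
  next
    fix s t M
    assume "R s t" and M: "M \<in> tran (naa_conj \<Sigma> A1 (A2 \<or>\<^sub>N A3)) s"
    from RE[OF \<open>R s t\<close>]
    show "\<exists>M' \<in> tran (naa_conj \<Sigma> A1 A2 \<or>\<^sub>N naa_conj \<Sigma> A1 A3) t. matched R M M'"
    proof (elim disjE exE conjE)
      fix s1 s2
      assume [simp]: "s = (s1, Inl s2)" "t = Inl (s1, s2)" and s: "s1 \<in> nstates A1" "s2 \<in> nstates A2"
      from M obtain M2 where M_states: "M \<subseteq> \<Sigma> \<times> (nstates A1 \<times> (nstates A2 <+> nstates A3))"
        and M1: "proj1 M \<in> tran A1 s1" and M2: "M2 \<in> tran A2 s2" "proj2 M = map_prod id Inl ` M2"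
        by auto
      \<comment> \<open>The second projection of \<open>M\<close> is a tagged copy of
        \<open>M2\<close>, so no element of \<open>M\<close> can touch the other summand.\<close>
      have M_Inl: "\<exists>t2. u = Inl t2 \<and> (a, t2) \<in> M2" if "(a, (t1, u)) \<in> M" for a t1 u
      proof -
        from that have "(a, u) \<in> proj2 M" by auto
        then show ?thesis by (simp add: M2(2))
      qed
      \<comment> \<open>\<open>M\<close> with the inner tags stripped. By \<open>M_Inl\<close>
        nothing is dropped, so the first projection is unchanged and the second becomes
        \<open>M2\<close>.\<close>
      define M' where "M' = {(a, (t1, t2)) | a t1 t2. (a, (t1, Inl t2)) \<in> M}"
      have "proj1 M' = proj1 M"
        by (auto simp: M'_def proj1_def dest: M_Inl)
      moreover have "proj2 M' = M2"
      proof (intro equalityI subrelI)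
        fix a t2
        assume "(a, t2) \<in> M2"
        then have "(a, Inl t2) \<in> proj2 M" by (simp add: M2(2))
        then show "(a, t2) \<in> proj2 M'" by (auto simp: M'_def)
      qed (auto simp: M'_def dest: M_Inl)
      moreover have "M' \<subseteq> \<Sigma> \<times> (nstates A1 \<times> nstates A2)"
        using M_states by (auto simp: M'_def)
      ultimately have "M' \<in> tran (naa_conj \<Sigma> A1 A2) (s1, s2)" using M1 M2(1) by simp
      moreover have "matched R M (map_prod id Inl ` M')"
      proof (rule matchedI)
        fix a t1
        assume "(a, t1) \<in> M"
        moreover obtain u v where "t1 = (u, v)" by (cases t1)
        ultimately show "\<exists>t2. (a, t2) \<in> map_prod id Inl ` M' \<and> R t1 t2"
          using M_states M_Inl by (fastforce simp: M'_def R_Inl)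
      next
        fix a and t2 :: "'s \<times> 't + 's \<times> 'u"
        assume "(a, t2) \<in> map_prod id Inl ` M'"
        then obtain u v where "t2 = Inl (u, v)" "(a, (u, Inl v)) \<in> M" by (auto simp: M'_def)
        with M_states show "\<exists>t1. (a, t1) \<in> M \<and> R t1 t2"
          by (intro exI[of _ "(u, Inl v)"]) (auto simp: R_Inl)
      qed
      ultimately show ?thesis by auto
    next
      fix s1 s2
      assume [simp]: "s = (s1, Inr s2)" "t = Inr (s1, s2)" and s: "s1 \<in> nstates A1" "s2 \<in> nstates A3"
      from M obtain M3 where M_states: "M \<subseteq> \<Sigma> \<times> (nstates A1 \<times> (nstates A2 <+> nstates A3))"
        and M1: "proj1 M \<in> tran A1 s1" and M3: "M3 \<in> tran A3 s2" "proj2 M = map_prod id Inr ` M3"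
        by auto
      have M_Inr: "\<exists>t2. u = Inr t2 \<and> (a, t2) \<in> M3" if "(a, (t1, u)) \<in> M" for a t1 u
      proof -
        from that have "(a, u) \<in> proj2 M" by auto
        then show ?thesis by (simp add: M3(2))
      qed
      define M' where "M' = {(a, (t1, t2)) | a t1 t2. (a, (t1, Inr t2)) \<in> M}"
      have "proj1 M' = proj1 M"
        by (auto simp: M'_def proj1_def dest: M_Inr)
      moreover have "proj2 M' = M3"
      proof (intro equalityI subrelI)
        fix a t2
        assume "(a, t2) \<in> M3"
        then have "(a, Inr t2) \<in> proj2 M" by (simp add: M3(2))
        then show "(a, t2) \<in> proj2 M'" by (auto simp: M'_def)
      qed (auto simp: M'_def dest: M_Inr)
      moreover have "M' \<subseteq> \<Sigma> \<times> (nstates A1 \<times> nstates A3)"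
        using M_states by (auto simp: M'_def)
      ultimately have "M' \<in> tran (naa_conj \<Sigma> A1 A3) (s1, s2)" using M1 M3(1) by simp
      moreover have "matched R M (map_prod id Inr ` M')"
      proof (rule matchedI)
        fix a t1
        assume "(a, t1) \<in> M"
        moreover obtain u v where "t1 = (u, v)" by (cases t1)
        ultimately show "\<exists>t2. (a, t2) \<in> map_prod id Inr ` M' \<and> R t1 t2"
          using M_states M_Inr by (fastforce simp: M'_def R_Inr)
      next
        fix a and t2 :: "'s \<times> 't + 's \<times> 'u"
        assume "(a, t2) \<in> map_prod id Inr ` M'"
        then obtain u v where "t2 = Inr (u, v)" "(a, (u, Inr v)) \<in> M" by (auto simp: M'_def)
        with M_states show "\<exists>t1. (a, t1) \<in> M \<and> R t1 t2"
          by (intro exI[of _ "(u, Inr v)"]) (auto simp: R_Inr)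
      qed
      ultimately show ?thesis by auto
    qed
  qed (auto dest!: RE)
qed

lemma naa_conj_disj_distrib:
  assumes "A1 \<in> NAA \<Sigma>" "A2 \<in> NAA \<Sigma>" "A3 \<in> NAA \<Sigma>"
  shows "naa_conj \<Sigma> A1 (A2 \<or>\<^sub>N A3) \<equiv>\<^sub>N (naa_conj \<Sigma> A1 A2) \<or>\<^sub>N (naa_conj \<Sigma> A1 A3)"
  unfolding naa_equiv_def
proof
  show "(naa_conj \<Sigma> A1 A2) \<or>\<^sub>N (naa_conj \<Sigma> A1 A3) \<le>\<^sub>N naa_conj \<Sigma> A1 (A2 \<or>\<^sub>N A3)"
    using assms
    by (intro naa_disj_least naa_conj_mono[where \<Sigma> = \<Sigma>] naa_le_refl[where \<Sigma> = \<Sigma>]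
        naa_disj_ge1[where \<Sigma> = \<Sigma>] naa_disj_ge2[where \<Sigma> = \<Sigma>] naa_disj_closed)
qed (rule naa_conj_disj_distrib_le[OF assms])

text \<open>The same lattice computation as for DMTS: expand over the second factor, absorb one part
  into \<open>A1\<close>, then swap and expand the other.\<close>

lemma naa_disj_conj_distrib:
  assumes A: "A1 \<in> NAA \<Sigma>" "A2 \<in> NAA \<Sigma>" "A3 \<in> NAA \<Sigma>"
  shows "A1 \<or>\<^sub>N (naa_conj \<Sigma> A2 A3) \<equiv>\<^sub>N naa_conj \<Sigma> (A1 \<or>\<^sub>N A2) (A1 \<or>\<^sub>N A3)"
  unfolding naa_equiv_def
proof
  note closed = A naa_conj_closed naa_disj_closed
  show "A1 \<or>\<^sub>N (naa_conj \<Sigma> A2 A3) \<le>\<^sub>N naa_conj \<Sigma> (A1 \<or>\<^sub>N A2) (A1 \<or>\<^sub>N A3)"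
    by (intro naa_conj_greatest naa_disj_mono[where \<Sigma> = \<Sigma>] naa_le_refl[where \<Sigma> = \<Sigma>]
        naa_conj_le1[where \<Sigma> = \<Sigma>] naa_conj_le2[where \<Sigma> = \<Sigma>] closed)
  let ?E = "A1 \<or>\<^sub>N A2"
  have "naa_conj \<Sigma> ?E (A1 \<or>\<^sub>N A3) \<le>\<^sub>N (naa_conj \<Sigma> ?E A1) \<or>\<^sub>N (naa_conj \<Sigma> ?E A3)"
    by (intro naa_conj_disj_distrib_le[where \<Sigma> = \<Sigma>] closed)
  moreover have "naa_conj \<Sigma> ?E A1 \<le>\<^sub>N A1 \<or>\<^sub>N (naa_conj \<Sigma> A2 A3)"
    by (rule naa_le_trans[OF naa_conj_le2[where \<Sigma> = \<Sigma>] naa_disj_ge1[where \<Sigma> = \<Sigma>]]) (intro closed)+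
  moreover have "naa_conj \<Sigma> ?E A3 \<le>\<^sub>N A1 \<or>\<^sub>N (naa_conj \<Sigma> A2 A3)"
  proof -
    have "naa_conj \<Sigma> ?E A3 \<le>\<^sub>N naa_conj \<Sigma> A3 ?E"
      by (intro naa_conj_greatest naa_conj_le1[where \<Sigma> = \<Sigma>]
          naa_conj_le2[where \<Sigma> = \<Sigma>] closed)
    moreover have "naa_conj \<Sigma> A3 ?E \<le>\<^sub>N (naa_conj \<Sigma> A3 A1) \<or>\<^sub>N (naa_conj \<Sigma> A3 A2)"
      by (intro naa_conj_disj_distrib_le[where \<Sigma> = \<Sigma>] closed)
    moreover have "(naa_conj \<Sigma> A3 A1) \<or>\<^sub>N (naa_conj \<Sigma> A3 A2) \<le>\<^sub>N A1 \<or>\<^sub>N (naa_conj \<Sigma> A2 A3)"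
      by (intro naa_disj_mono[where \<Sigma> = \<Sigma>] naa_conj_greatest
          naa_conj_le1[where \<Sigma> = \<Sigma>] naa_conj_le2[where \<Sigma> = \<Sigma>] closed)
    ultimately show ?thesis by (blast intro: naa_le_trans)
  qed
  ultimately show "naa_conj \<Sigma> ?E (A1 \<or>\<^sub>N A3) \<le>\<^sub>N A1 \<or>\<^sub>N (naa_conj \<Sigma> A2 A3)"
    by (blast intro: naa_le_trans naa_disj_least)
qed

theorem theorem4:
  fixes \<Sigma> :: "'l set"
  assumes "finite \<Sigma>"
  shows
    "((\<forall>D1 \<in> DMTS \<Sigma> :: ('l, 'a) dmts set. D1 \<le>\<^sub>D D1) \<and>
      (\<forall>D1 \<in> DMTS \<Sigma> :: ('l, 'a) dmts set.
        \<forall>D2 \<in> DMTS \<Sigma> :: ('l, 'b) dmts set.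
        \<forall>D3 \<in> DMTS \<Sigma> :: ('l, 'c) dmts set.
        D1 \<le>\<^sub>D D2 \<longrightarrow> D2 \<le>\<^sub>D D3 \<longrightarrow> D1 \<le>\<^sub>D D3) \<and>
      (\<forall>D1 \<in> DMTS \<Sigma> :: ('l, 'a) dmts set.
        \<forall>D2 \<in> DMTS \<Sigma> :: ('l, 'b) dmts set.
        D1 \<and>\<^sub>D D2 \<in> DMTS \<Sigma> \<and> D1 \<or>\<^sub>D D2 \<in> DMTS \<Sigma>) \<and>
      (\<forall>D1 \<in> DMTS \<Sigma> :: ('l, 'a) dmts set.
        \<forall>D2 \<in> DMTS \<Sigma> :: ('l, 'b) dmts set.
        \<forall>D3 \<in> DMTS \<Sigma> :: ('l, 'c) dmts set.
        \<forall>D4 \<in> DMTS \<Sigma> :: ('l, 'd) dmts set.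
        D1 \<equiv>\<^sub>D D3 \<longrightarrow> D2 \<equiv>\<^sub>D D4 \<longrightarrow>
        D1 \<and>\<^sub>D D2 \<equiv>\<^sub>D D3 \<and>\<^sub>D D4 \<and> D1 \<or>\<^sub>D D2 \<equiv>\<^sub>D D3 \<or>\<^sub>D D4) \<and>
      (\<forall>D1 \<in> DMTS \<Sigma> :: ('l, 'a) dmts set.
        \<forall>D2 \<in> DMTS \<Sigma> :: ('l, 'b) dmts set.
        D1 \<and>\<^sub>D D2 \<le>\<^sub>D D1 \<and> D1 \<and>\<^sub>D D2 \<le>\<^sub>D D2) \<and>
      (\<forall>D1 \<in> DMTS \<Sigma> :: ('l, 'a) dmts set.
        \<forall>D2 \<in> DMTS \<Sigma> :: ('l, 'b) dmts set.
        \<forall>D3 \<in> DMTS \<Sigma> :: ('l, 'c) dmts set.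
        D3 \<le>\<^sub>D D1 \<longrightarrow> D3 \<le>\<^sub>D D2 \<longrightarrow> D3 \<le>\<^sub>D D1 \<and>\<^sub>D D2) \<and>
      (\<forall>D1 \<in> DMTS \<Sigma> :: ('l, 'a) dmts set.
        \<forall>D2 \<in> DMTS \<Sigma> :: ('l, 'b) dmts set.
        D1 \<le>\<^sub>D D1 \<or>\<^sub>D D2 \<and> D2 \<le>\<^sub>D D1 \<or>\<^sub>D D2) \<and>
      (\<forall>D1 \<in> DMTS \<Sigma> :: ('l, 'a) dmts set.
        \<forall>D2 \<in> DMTS \<Sigma> :: ('l, 'b) dmts set.
        \<forall>D3 \<in> DMTS \<Sigma> :: ('l, 'c) dmts set.
        D1 \<le>\<^sub>D D3 \<longrightarrow> D2 \<le>\<^sub>D D3 \<longrightarrow> D1 \<or>\<^sub>D D2 \<le>\<^sub>D D3) \<and>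
      dmts_bot \<in> DMTS \<Sigma> \<and> dmts_top \<Sigma> \<in> DMTS \<Sigma> \<and>
      (\<forall>D1 \<in> DMTS \<Sigma> :: ('l, 'a) dmts set. dmts_bot \<le>\<^sub>D D1 \<and> D1 \<le>\<^sub>D dmts_top \<Sigma>) \<and>
      (\<forall>D1 \<in> DMTS \<Sigma> :: ('l, 'a) dmts set.
        \<forall>D2 \<in> DMTS \<Sigma> :: ('l, 'b) dmts set.
        \<forall>D3 \<in> DMTS \<Sigma> :: ('l, 'c) dmts set.
        D1 \<and>\<^sub>D (D2 \<or>\<^sub>D D3) \<equiv>\<^sub>D (D1 \<and>\<^sub>D D2) \<or>\<^sub>D (D1 \<and>\<^sub>D D3)) \<and>
      (\<forall>D1 \<in> DMTS \<Sigma> :: ('l, 'a) dmts set.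
        \<forall>D2 \<in> DMTS \<Sigma> :: ('l, 'b) dmts set.
        \<forall>D3 \<in> DMTS \<Sigma> :: ('l, 'c) dmts set.
        D1 \<or>\<^sub>D (D2 \<and>\<^sub>D D3) \<equiv>\<^sub>D (D1 \<or>\<^sub>D D2) \<and>\<^sub>D (D1 \<or>\<^sub>D D3))) \<and>
     ((\<forall>A1 \<in> NAA \<Sigma> :: ('l, 'a) naa set. A1 \<le>\<^sub>N A1) \<and>
      (\<forall>A1 \<in> NAA \<Sigma> :: ('l, 'a) naa set.
        \<forall>A2 \<in> NAA \<Sigma> :: ('l, 'b) naa set.
        \<forall>A3 \<in> NAA \<Sigma> :: ('l, 'c) naa set.
        A1 \<le>\<^sub>N A2 \<longrightarrow> A2 \<le>\<^sub>N A3 \<longrightarrow> A1 \<le>\<^sub>N A3) \<and>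
      (\<forall>A1 \<in> NAA \<Sigma> :: ('l, 'a) naa set.
        \<forall>A2 \<in> NAA \<Sigma> :: ('l, 'b) naa set.
        naa_conj \<Sigma> A1 A2 \<in> NAA \<Sigma> \<and> A1 \<or>\<^sub>N A2 \<in> NAA \<Sigma>) \<and>
      (\<forall>A1 \<in> NAA \<Sigma> :: ('l, 'a) naa set.
        \<forall>A2 \<in> NAA \<Sigma> :: ('l, 'b) naa set.
        \<forall>A3 \<in> NAA \<Sigma> :: ('l, 'c) naa set.
        \<forall>A4 \<in> NAA \<Sigma> :: ('l, 'd) naa set.
        A1 \<equiv>\<^sub>N A3 \<longrightarrow> A2 \<equiv>\<^sub>N A4 \<longrightarrow>
        naa_conj \<Sigma> A1 A2 \<equiv>\<^sub>N naa_conj \<Sigma> A3 A4 \<and> A1 \<or>\<^sub>N A2 \<equiv>\<^sub>N A3 \<or>\<^sub>N A4) \<and>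
      (\<forall>A1 \<in> NAA \<Sigma> :: ('l, 'a) naa set.
        \<forall>A2 \<in> NAA \<Sigma> :: ('l, 'b) naa set.
        naa_conj \<Sigma> A1 A2 \<le>\<^sub>N A1 \<and> naa_conj \<Sigma> A1 A2 \<le>\<^sub>N A2) \<and>
      (\<forall>A1 \<in> NAA \<Sigma> :: ('l, 'a) naa set.
        \<forall>A2 \<in> NAA \<Sigma> :: ('l, 'b) naa set.
        \<forall>A3 \<in> NAA \<Sigma> :: ('l, 'c) naa set.
        A3 \<le>\<^sub>N A1 \<longrightarrow> A3 \<le>\<^sub>N A2 \<longrightarrow> A3 \<le>\<^sub>N naa_conj \<Sigma> A1 A2) \<and>
      (\<forall>A1 \<in> NAA \<Sigma> :: ('l, 'a) naa set.
        \<forall>A2 \<in> NAA \<Sigma> :: ('l, 'b) naa set.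
        A1 \<le>\<^sub>N A1 \<or>\<^sub>N A2 \<and> A2 \<le>\<^sub>N A1 \<or>\<^sub>N A2) \<and>
      (\<forall>A1 \<in> NAA \<Sigma> :: ('l, 'a) naa set.
        \<forall>A2 \<in> NAA \<Sigma> :: ('l, 'b) naa set.
        \<forall>A3 \<in> NAA \<Sigma> :: ('l, 'c) naa set.
        A1 \<le>\<^sub>N A3 \<longrightarrow> A2 \<le>\<^sub>N A3 \<longrightarrow> A1 \<or>\<^sub>N A2 \<le>\<^sub>N A3) \<and>
      naa_bot \<in> NAA \<Sigma> \<and> naa_top \<Sigma> \<in> NAA \<Sigma> \<and>
      (\<forall>A1 \<in> NAA \<Sigma> :: ('l, 'a) naa set. naa_bot \<le>\<^sub>N A1 \<and> A1 \<le>\<^sub>N naa_top \<Sigma>) \<and>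
      (\<forall>A1 \<in> NAA \<Sigma> :: ('l, 'a) naa set.
        \<forall>A2 \<in> NAA \<Sigma> :: ('l, 'b) naa set.
        \<forall>A3 \<in> NAA \<Sigma> :: ('l, 'c) naa set.
        naa_conj \<Sigma> A1 (A2 \<or>\<^sub>N A3) \<equiv>\<^sub>N (naa_conj \<Sigma> A1 A2) \<or>\<^sub>N (naa_conj \<Sigma> A1 A3)) \<and>
      (\<forall>A1 \<in> NAA \<Sigma> :: ('l, 'a) naa set.
        \<forall>A2 \<in> NAA \<Sigma> :: ('l, 'b) naa set.
        \<forall>A3 \<in> NAA \<Sigma> :: ('l, 'c) naa set.
        A1 \<or>\<^sub>N (naa_conj \<Sigma> A2 A3) \<equiv>\<^sub>N naa_conj \<Sigma> (A1 \<or>\<^sub>N A2) (A1 \<or>\<^sub>N A3)))"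
  \<comment> \<open>After introduction each conjunct is an instance of one of the listed rules with
    its premises among the assumptions; inserting \<open>assms\<close> makes
    \<open>finite \<Sigma>\<close> available for \<open>naa_top_closed\<close>.\<close>
  by (insert assms, intro conjI ballI impI;
      (rule dmts_le_refl dmts_le_trans dmts_conj_closed dmts_disj_closed dmts_conj_cong dmts_disj_cong
        dmts_conj_le1 dmts_conj_le2 dmts_conj_greatest dmts_disj_ge1 dmts_disj_ge2 dmts_disj_least
        dmts_bot_closed dmts_top_closed dmts_bot_le dmts_le_top dmts_conj_disj_distrib dmts_disj_conj_distrib
        naa_le_refl naa_le_trans naa_conj_closed naa_disj_closed naa_conj_cong naa_disj_cong
        naa_conj_le1 naa_conj_le2 naa_conj_greatest naa_disj_ge1 naa_disj_ge2 naa_disj_least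
        naa_bot_closed naa_top_closed naa_bot_le naa_le_top naa_conj_disj_distrib naa_disj_conj_distrib;
       assumption))

end
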